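(* Let $(M,\varphi,\xi,\eta,g)$ be a contact metric $(\kappa,\mu)$-manifold such that $|I_M|>1$, where $I_M=\frac{1-\mu/2}{\sqrt{1-\kappa}}$. Then $M$ admits a compatible Sasakian structure, i.e. a Sasakian structure $(\varphi',\xi,\eta,g')$ with the same contact form $\eta$.
   Context: Convention: $2d\eta(X,Y)=X(\eta(Y))-Y(\eta(X))-\eta([X,Y])$. A contact manifold is a $(2n+1)$-dimensional smooth manifold $M$ with a 1-form $\eta$ such that $\eta\wedge(d\eta)^n\neq0$ everywhere; its Reeb vector field $\xi$ is determined by $\eta(\xi)=1$, $i_\xi d\eta=0$. A contact metric structure $(\varphi,\xi,\eta,g)$ compatible with $\eta$ consists of $\eta$, its Reeb field $\xi$, a $(1,1)$-tensor field $\varphi$ and a Riemannian metric $g$ with $\varphi^2=-I+\eta\otimes\xi$, $d\eta(X,Y)=g(X,\varphi Y)$, $g(\varphi X,\varphi Y)=g(X,Y)-\eta(X)\eta(Y)$. Put $h=\frac12{\mathcal L}_\xi\varphi$. It is Sasakian if $R_{XY}\xi=\eta(Y)X-\eta(X)Y$ ($R$ the Levi-Civita curvature of $g$). It is a contact metric $(\kappa,\mu)$-manifold ($\kappa,\mu\in\mathbb{R}$) if $R_{XY}\xi=\kappa(\eta(Y)X-\eta(X)Y)+\mu(\eta(Y)hX-\eta(X)hY)$ for all vector fields $X,Y$. Then $\kappa\le1$, with $\kappa=1$ exactly when the structure is Sasakian. The number $I_M$ is defined for non-Sasakian contact metric $(\kappa,\mu)$-manifolds, i.e. when $\kappa<1$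 (for a Sasakian structure the claim is trivial). *)

theory Defs
  imports "HOL-Analysis.Analysis" "HOL-Library.Function_Algebras"
begin

section \<open>Smooth manifolds\<close>

text \<open>
  Everything below is used on an open set \<open>S\<close>, where the Frechet derivative is unique.
  A map is \<open>C^(k+1)\<close> if it is differentiable and all its directional derivatives are \<open>C^k\<close>.
\<close>

primrec Ck_on :: "nat \<Rightarrow> ('e::euclidean_space \<Rightarrow> 'b::real_normed_vector) \<Rightarrow> 'e set \<Rightarrow> bool" where
  "Ck_on 0 f S \<longleftrightarrow> continuous_on S f"
| "Ck_on (Suc k) f S \<longleftrightarrow>
     f differentiable_on S \<and> (\<forall>v. Ck_on k (\<lambda>x. frechet_derivative f (at x) v) S)"

definition Cinf_on :: "('e::euclidean_space \<Rightarrow> 'b::real_normed_vector) \<Rightarrow> 'e set \<Rightarrow> bool" where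
  "Cinf_on f S \<longleftrightarrow> (\<forall>k. Ck_on k f S)"

text \<open>
  A chart is a pair \<open>(U, \<psi>)\<close> of a coordinate domain and a coordinate map; the values of
  \<open>\<psi>\<close> outside \<open>U\<close> are irrelevant. The underlying topological space is the type \<open>'a\<close>,
  and the dimension of the manifold is \<open>DIM('e)\<close>.
\<close>

type_synonym ('a, 'e) atlas = "('a set \<times> ('a \<Rightarrow> 'e)) set"

definition smooth_manifold ::
    "('a::{t2_space,second_countable_topology}, 'e::euclidean_space) atlas \<Rightarrow> bool" where
  "smooth_manifold A \<longleftrightarrow>
     (\<forall>(U, \<psi>)\<in>A. open U \<and> open (\<psi> ` U) \<and> homeomorphism U (\<psi> ` U) \<psi> (inv_into U \<psi>)) \<and>
     (\<Union>(U, \<psi>)\<in>A. U) = UNIV \<and>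
     (\<forall>(U, \<psi>)\<in>A. \<forall>(V, \<theta>)\<in>A. Cinf_on (\<theta> \<circ> inv_into U \<psi>) (\<psi> ` (U \<inter> V)))"

definition smooth_functions ::
    "('a::{t2_space,second_countable_topology}, 'e::euclidean_space) atlas \<Rightarrow> ('a \<Rightarrow> real) set" where
  "smooth_functions A = {f. \<forall>(U, \<psi>)\<in>A. Cinf_on (f \<circ> inv_into U \<psi>) (\<psi> ` U)}"

text \<open>
  Vector fields are the derivations of the algebra of smooth functions: \<open>X f\<close> is the function
  \<open>p \<mapsto> X\<^sub>p f\<close>. To make equality of vector fields the equality of HOL, a vector field
  maps every function that is not smooth to zero. Sums, differences and products of functions,
  and sums and differences of vector fields, are the pointwise ones.
\<close>

type_synonym 'a vfield = "('a \<Rightarrow> real) \<Rightarrow> ('a \<Rightarrow> real)"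

definition vector_fields ::
    "('a::{t2_space,second_countable_topology}, 'e::euclidean_space) atlas \<Rightarrow> 'a vfield set" where
  "vector_fields A = {X.
     (\<forall>f. f \<notin> smooth_functions A \<longrightarrow> X f = 0) \<and>
     (\<forall>f\<in>smooth_functions A. X f \<in> smooth_functions A) \<and>
     (\<forall>f\<in>smooth_functions A. \<forall>f'\<in>smooth_functions A. X (f + f') = X f + X f') \<and>
     (\<forall>c. \<forall>f\<in>smooth_functions A. X (\<lambda>p. c * f p) = (\<lambda>p. c * X f p)) \<and>
     (\<forall>f\<in>smooth_functions A. \<forall>f'\<in>smooth_functions A. X (f * f') = f * X f' + X f * f')}"

definition nonzero_at ::
    "('a::{t2_space,second_countable_topology}, 'e::euclidean_space) atlas \<Rightarrow> 'a vfield \<Rightarrow> 'a \<Rightarrow> bool" where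
  "nonzero_at A X p \<longleftrightarrow> (\<exists>f\<in>smooth_functions A. X f p \<noteq> 0)"

definition fscale :: "('a \<Rightarrow> real) \<Rightarrow> 'a vfield \<Rightarrow> 'a vfield" (infixr "\<cdot>" 75) where
  "f \<cdot> X = (\<lambda>u. f * X u)"

abbreviation cscale :: "real \<Rightarrow> 'a vfield \<Rightarrow> 'a vfield" where
  "cscale c X \<equiv> (\<lambda>_. c) \<cdot> X"

definition lie_bracket :: "'a vfield \<Rightarrow> 'a vfield \<Rightarrow> 'a vfield" where
  "lie_bracket X Y = (\<lambda>f. X (Y f) - Y (X f))"


section \<open>Tensor fields and forms\<close>

text \<open>
  Tensor fields are given by their action on vector fields, that is, as maps that are
  multilinear over the ring of smooth functions. Their values on arguments that are not vector
  fields are irrelevant.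
\<close>

definition one_form ::
    "('a::{t2_space,second_countable_topology}, 'e::euclidean_space) atlas \<Rightarrow>
     ('a vfield \<Rightarrow> 'a \<Rightarrow> real) \<Rightarrow> bool" where
  "one_form A \<alpha> \<longleftrightarrow>
     (\<forall>X\<in>vector_fields A. \<alpha> X \<in> smooth_functions A) \<and>
     (\<forall>X\<in>vector_fields A. \<forall>Y\<in>vector_fields A. \<alpha> (X + Y) = \<alpha> X + \<alpha> Y) \<and>
     (\<forall>f\<in>smooth_functions A. \<forall>X\<in>vector_fields A. \<alpha> (f \<cdot> X) = f * \<alpha> X)"

definition tensor_field_11 ::
    "('a::{t2_space,second_countable_topology}, 'e::euclidean_space) atlas \<Rightarrow>
     ('a vfield \<Rightarrow> 'a vfield) \<Rightarrow> bool" where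
  "tensor_field_11 A T \<longleftrightarrow>
     (\<forall>X\<in>vector_fields A. T X \<in> vector_fields A) \<and>
     (\<forall>X\<in>vector_fields A. \<forall>Y\<in>vector_fields A. T (X + Y) = T X + T Y) \<and>
     (\<forall>f\<in>smooth_functions A. \<forall>X\<in>vector_fields A. T (f \<cdot> X) = f \<cdot> T X)"

definition riemannian_metric ::
    "('a::{t2_space,second_countable_topology}, 'e::euclidean_space) atlas \<Rightarrow>
     ('a vfield \<Rightarrow> 'a vfield \<Rightarrow> 'a \<Rightarrow> real) \<Rightarrow> bool" where
  "riemannian_metric A g \<longleftrightarrow>
     (\<forall>X\<in>vector_fields A. one_form A (g X)) \<and>
     (\<forall>X\<in>vector_fields A. \<forall>Y\<in>vector_fields A. g X Y = g Y X) \<and>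
     (\<forall>X\<in>vector_fields A. \<forall>p. nonzero_at A X p \<longrightarrow> g X X p > 0)"

text \<open>The convention is \<open>2 d\<eta>(X,Y) = X(\<eta>(Y)) - Y(\<eta>(X)) - \<eta>([X,Y])\<close>.\<close>

definition ext_deriv :: "('a vfield \<Rightarrow> 'a \<Rightarrow> real) \<Rightarrow> 'a vfield \<Rightarrow> 'a vfield \<Rightarrow> 'a \<Rightarrow> real" where
  "ext_deriv \<alpha> X Y = (\<lambda>p. (X (\<alpha> Y) p - Y (\<alpha> X) p - \<alpha> (lie_bracket X Y) p) / 2)"

text \<open>
  A \<open>k\<close>-form takes a sequence of vector fields and depends on the first \<open>k\<close> of them only.
  The factor in the wedge product is the one that goes with the convention for \<open>d\<eta>\<close>.
\<close>

type_synonym 'a form = "(nat \<Rightarrow> 'a vfield) \<Rightarrow> 'a \<Rightarrow> real"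

definition wedge :: "nat \<Rightarrow> nat \<Rightarrow> 'a form \<Rightarrow> 'a form \<Rightarrow> 'a form" where
  "wedge k l \<alpha> \<beta> = (\<lambda>X p. (\<Sum>\<sigma> | \<sigma> permutes {..<k + l}.
     of_int (sign \<sigma>) * \<alpha> (\<lambda>i. X (\<sigma> i)) p * \<beta> (\<lambda>i. X (\<sigma> (k + i))) p) / fact (k + l))"

primrec two_form_power :: "'a form \<Rightarrow> nat \<Rightarrow> 'a form" where
  "two_form_power \<omega> 0 = (\<lambda>X p. 1)"
| "two_form_power \<omega> (Suc m) = wedge 2 (2 * m) \<omega> (two_form_power \<omega> m)"


section \<open>Levi-Civita connection and curvature\<close>

definition levi_civita_connection ::
    "('a::{t2_space,second_countable_topology}, 'e::euclidean_space) atlas \<Rightarrow>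
     ('a vfield \<Rightarrow> 'a vfield \<Rightarrow> 'a \<Rightarrow> real) \<Rightarrow> ('a vfield \<Rightarrow> 'a vfield \<Rightarrow> 'a vfield) \<Rightarrow> bool" where
  "levi_civita_connection A g D \<longleftrightarrow>
     (\<forall>X\<in>vector_fields A. \<forall>Y\<in>vector_fields A. D X Y \<in> vector_fields A) \<and>
     (\<forall>X\<in>vector_fields A. \<forall>Y\<in>vector_fields A. \<forall>Z\<in>vector_fields A.
        D (X + Y) Z = D X Z + D Y Z) \<and>
     (\<forall>f\<in>smooth_functions A. \<forall>X\<in>vector_fields A. \<forall>Y\<in>vector_fields A.
        D (f \<cdot> X) Y = f \<cdot> D X Y) \<and>
     (\<forall>X\<in>vector_fields A. \<forall>Y\<in>vector_fields A. \<forall>Z\<in>vector_fields A.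
        D X (Y + Z) = D X Y + D X Z) \<and>
     (\<forall>f\<in>smooth_functions A. \<forall>X\<in>vector_fields A. \<forall>Y\<in>vector_fields A.
        D X (f \<cdot> Y) = X f \<cdot> Y + f \<cdot> D X Y) \<and>
     (\<forall>X\<in>vector_fields A. \<forall>Y\<in>vector_fields A. D X Y - D Y X = lie_bracket X Y) \<and>
     (\<forall>X\<in>vector_fields A. \<forall>Y\<in>vector_fields A. \<forall>Z\<in>vector_fields A.
        X (g Y Z) = g (D X Y) Z + g Y (D X Z))"

definition curvature ::
    "('a vfield \<Rightarrow> 'a vfield \<Rightarrow> 'a vfield) \<Rightarrow> 'a vfield \<Rightarrow> 'a vfield \<Rightarrow> 'a vfield \<Rightarrow> 'a vfield" where
  "curvature D X Y Z = D X (D Y Z) - D Y (D X Z) - D (lie_bracket X Y) Z"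


section \<open>Contact metric structures\<close>

definition contact_manifold ::
    "('a::{t2_space,second_countable_topology}, 'e::euclidean_space) atlas \<Rightarrow> nat \<Rightarrow>
     ('a vfield \<Rightarrow> 'a \<Rightarrow> real) \<Rightarrow> bool" where
  "contact_manifold A n \<eta> \<longleftrightarrow>
     smooth_manifold A \<and> DIM('e) = 2 * n + 1 \<and> one_form A \<eta> \<and>
     (\<forall>p. \<exists>X. (\<forall>i. X i \<in> vector_fields A) \<and>
        wedge 1 (2 * n) (\<lambda>X. \<eta> (X 0))
          (two_form_power (\<lambda>X. ext_deriv \<eta> (X 0) (X 1)) n) X p \<noteq> 0)"

definition reeb_field ::
    "('a::{t2_space,second_countable_topology}, 'e::euclidean_space) atlas \<Rightarrow>
     ('a vfield \<Rightarrow> 'a \<Rightarrow> real) \<Rightarrow> 'a vfield \<Rightarrow> bool" where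
  "reeb_field A \<eta> \<xi> \<longleftrightarrow>
     \<xi> \<in> vector_fields A \<and> \<eta> \<xi> = 1 \<and> (\<forall>X\<in>vector_fields A. ext_deriv \<eta> \<xi> X = 0)"

definition contact_metric_structure ::
    "('a::{t2_space,second_countable_topology}, 'e::euclidean_space) atlas \<Rightarrow> nat \<Rightarrow>
     ('a vfield \<Rightarrow> 'a vfield) \<Rightarrow> 'a vfield \<Rightarrow> ('a vfield \<Rightarrow> 'a \<Rightarrow> real) \<Rightarrow>
     ('a vfield \<Rightarrow> 'a vfield \<Rightarrow> 'a \<Rightarrow> real) \<Rightarrow> bool" where
  "contact_metric_structure A n \<phi> \<xi> \<eta> g \<longleftrightarrow>
     contact_manifold A n \<eta> \<and> reeb_field A \<eta> \<xi> \<and>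
     tensor_field_11 A \<phi> \<and> riemannian_metric A g \<and>
     (\<forall>X\<in>vector_fields A. \<phi> (\<phi> X) = - X + \<eta> X \<cdot> \<xi>) \<and>
     (\<forall>X\<in>vector_fields A. \<forall>Y\<in>vector_fields A. ext_deriv \<eta> X Y = g X (\<phi> Y)) \<and>
     (\<forall>X\<in>vector_fields A. \<forall>Y\<in>vector_fields A. g (\<phi> X) (\<phi> Y) = g X Y - \<eta> X * \<eta> Y)"

definition lie_deriv_11 :: "'a vfield \<Rightarrow> ('a vfield \<Rightarrow> 'a vfield) \<Rightarrow> 'a vfield \<Rightarrow> 'a vfield" where
  "lie_deriv_11 V T X = lie_bracket V (T X) - T (lie_bracket V X)"

definition h_tensor :: "('a vfield \<Rightarrow> 'a vfield) \<Rightarrow> 'a vfield \<Rightarrow> 'a vfield \<Rightarrow> 'a vfield" where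
  "h_tensor \<phi> \<xi> X = cscale (1 / 2) (lie_deriv_11 \<xi> \<phi> X)"

text \<open>
  A Riemannian metric has exactly one Levi-Civita connection on its vector fields, so the
  existential quantifiers below only introduce a name for it.
\<close>

definition kappa_mu_structure ::
    "('a::{t2_space,second_countable_topology}, 'e::euclidean_space) atlas \<Rightarrow> nat \<Rightarrow>
     ('a vfield \<Rightarrow> 'a vfield) \<Rightarrow> 'a vfield \<Rightarrow> ('a vfield \<Rightarrow> 'a \<Rightarrow> real) \<Rightarrow>
     ('a vfield \<Rightarrow> 'a vfield \<Rightarrow> 'a \<Rightarrow> real) \<Rightarrow> real \<Rightarrow> real \<Rightarrow> bool" where
  "kappa_mu_structure A n \<phi> \<xi> \<eta> g \<kappa> \<mu> \<longleftrightarrow>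
     contact_metric_structure A n \<phi> \<xi> \<eta> g \<and>
     (\<exists>D. levi_civita_connection A g D \<and>
       (\<forall>X\<in>vector_fields A. \<forall>Y\<in>vector_fields A.
          curvature D X Y \<xi> =
            cscale \<kappa> (\<eta> Y \<cdot> X - \<eta> X \<cdot> Y) +
            cscale \<mu> (\<eta> Y \<cdot> h_tensor \<phi> \<xi> X - \<eta> X \<cdot> h_tensor \<phi> \<xi> Y)))"

definition sasakian_structure ::
    "('a::{t2_space,second_countable_topology}, 'e::euclidean_space) atlas \<Rightarrow> nat \<Rightarrow>
     ('a vfield \<Rightarrow> 'a vfield) \<Rightarrow> 'a vfield \<Rightarrow> ('a vfield \<Rightarrow> 'a \<Rightarrow> real) \<Rightarrow>
     ('a vfield \<Rightarrow> 'a vfield \<Rightarrow> 'a \<Rightarrow> real) \<Rightarrow> bool" where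
  "sasakian_structure A n \<phi> \<xi> \<eta> g \<longleftrightarrow>
     contact_metric_structure A n \<phi> \<xi> \<eta> g \<and>
     (\<exists>D. levi_civita_connection A g D \<and>
       (\<forall>X\<in>vector_fields A. \<forall>Y\<in>vector_fields A.
          curvature D X Y \<xi> = \<eta> Y \<cdot> X - \<eta> X \<cdot> Y))"

text \<open>The invariant \<open>I\<^sub>M\<close>; it is meaningful for \<open>\<kappa> < 1\<close> only.\<close>

definition boeckx_invariant :: "real \<Rightarrow> real \<Rightarrow> real" where
  "boeckx_invariant \<kappa> \<mu> = (1 - \<mu> / 2) / sqrt (1 - \<kappa>)"

end

theory Submission
  imports Defs
begin

text \<open>
  Write \<open>B = \<phi> h\<close> and \<open>\<alpha> = 1 - \<mu>/2\<close>. The Sasakian structure is a deformation of the given one along \<open>h\<close>: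
  \<open>\<phi>' = a \<phi> + b B\<close> and \<open>g' = a g(X, Y) + b g(hX, Y) + (1 - a) \<eta>(X) \<eta>(Y)\<close> with
  \<open>a = \<bar>\<alpha>\<bar> / s\<close>, \<open>b = sgn \<alpha> / s\<close> and \<open>s\<^sup>2 = \<alpha>\<^sup>2 - (1 - \<kappa>)\<close>. The relation
  \<open>a\<^sup>2 - b\<^sup>2 (1 - \<kappa>) = 1\<close> makes it an almost contact structure, since \<open>h\<^sup>2 = (\<kappa> - 1) \<phi>\<^sup>2\<close>, and
  \<open>\<bar>I\<^sub>M\<bar> > 1\<close> makes \<open>g'\<close> positive. The relation \<open>a = b \<alpha>\<close> makes \<open>\<xi>\<close> a Killing field of \<open>g'\<close>.
  The Levi-Civita connection of \<open>g'\<close> is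
  \<open>D'\<^sub>X Y = D\<^sub>X Y - g(BX, Y) \<xi> + \<eta>(X) SY + \<eta>(Y) SX\<close> with \<open>S = (1 - a) \<phi> + (1 - b) B\<close>.

  Checking this, and computing the curvature of \<open>D'\<close>, requires \<open>D\<phi>\<close> and \<open>DB\<close>. Both are determined by
  their components along \<open>ker \<eta>\<close>, which vanish: there the nullity condition says that
  \<open>D(\<phi> + B)\<close> is symmetric in its two arguments, and together with \<open>d(d\<eta>) = 0\<close> and the
  derivatives of \<open>\<phi>\<^sup>2\<close>, \<open>\<phi>B + B\<phi>\<close> and \<open>B\<^sup>2\<close> this is a linear system with trivial solution.
\<close>


section \<open>Smooth functions\<close>

text \<open>On an open set the derivative depends only on values inside the set, so the recursion
  carries over. This permits replacing \<open>frechet_derivative\<close> by an explicit formula in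
  \<open>Ck_on_SucI\<close>.\<close>

lemma Ck_on_cong:
  assumes "open S" "\<And>x. x \<in> S \<Longrightarrow> f x = f' x" "Ck_on k f S"
  shows "Ck_on k f' S"
  using assms(2,3)
proof (induction k arbitrary: f f')
  case 0
  then show ?case by (simp add: continuous_on_eq)
next
  case (Suc k)
  have d: "(f' has_derivative frechet_derivative f (at x)) (at x)" if "x \<in> S" for x
  proof -
    have "f differentiable at x"
      using Suc.prems(2) that assms(1) by (auto simp: differentiable_on_eq_differentiable_at)
    then have "(f has_derivative frechet_derivative f (at x)) (at x)"
      by (simp add: frechet_derivative_works)
    then show ?thesis
      using has_derivative_transform_within_open[OF _ assms(1) that] Suc.prems(1) by blast
  qed
  have eq: "frechet_derivative f' (at x) = frechet_derivative f (at x)" if "x \<in> S" for x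
    using d[OF that] frechet_derivative_at by metis
  have "f' differentiable_on S"
    using d assms(1) differentiableI by (auto simp: differentiable_on_eq_differentiable_at)
  moreover have "Ck_on k (\<lambda>x. frechet_derivative f' (at x) v) S" for v
    by (rule Suc.IH[of "\<lambda>x. frechet_derivative f (at x) v"]) (use Suc.prems(2) eq in auto)
  ultimately show ?case by simp
qed

lemma Ck_on_SucI:
  assumes "open S" "\<And>x. x \<in> S \<Longrightarrow> (f has_derivative f' x) (at x)"
    and "\<And>v. Ck_on k (\<lambda>x. f' x v) S"
  shows "Ck_on (Suc k) f S"
proof -
  have "f' x v = frechet_derivative f (at x) v" if "x \<in> S" for x v
    using assms(2)[OF that] frechet_derivative_at by metis
  then have "Ck_on k (\<lambda>x. frechet_derivative f (at x) v) S" for v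
    by (intro Ck_on_cong[OF assms(1) _ assms(3)])
  moreover have "f differentiable at x" if "x \<in> S" for x
    using assms(2)[OF that] differentiableI by blast
  ultimately show ?thesis
    using assms(1) by (auto simp: differentiable_on_eq_differentiable_at)
qed

lemma Ck_on_SucD: "Ck_on (Suc k) f S \<Longrightarrow> Ck_on k f S"
proof (induction k arbitrary: f)
  case 0
  then show ?case by (simp add: differentiable_imp_continuous_on)
qed simp

lemma Ck_on_has_derivative:
  assumes "Ck_on (Suc k) f S" "open S" "x \<in> S"
  shows "(f has_derivative frechet_derivative f (at x)) (at x)"
  using assms by (auto simp: differentiable_on_eq_differentiable_at frechet_derivative_works)

lemma Ck_on_const:
  assumes "open S"
  shows "Ck_on k (\<lambda>x. c) S"
proof (induction k arbitrary: c)
  case (Suc k)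
  then show ?case by (intro Ck_on_SucI[where f' = "\<lambda>x v. 0"] assms) auto
qed simp

lemma Ck_on_add:
  assumes "open S" "Ck_on k f S" "Ck_on k f' S"
  shows "Ck_on k (\<lambda>x. f x + f' x) S"
  using assms(2,3)
proof (induction k arbitrary: f f')
  case 0
  then show ?case by (simp add: continuous_on_add)
next
  case (Suc k)
  show ?case
  proof (rule Ck_on_SucI[OF assms(1)])
    show "((\<lambda>x. f x + f' x) has_derivative
        (\<lambda>v. frechet_derivative f (at x) v + frechet_derivative f' (at x) v)) (at x)"
      if "x \<in> S" for x
      using Suc.prems[THEN Ck_on_has_derivative, OF assms(1) that] by (rule has_derivative_add)
    show "Ck_on k (\<lambda>x. frechet_derivative f (at x) v + frechet_derivative f' (at x) v) S" for v
      by (intro Suc.IH) (use Suc.prems in auto)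
  qed
qed

lemma Ck_on_mult:
  fixes f f' :: "'e::euclidean_space \<Rightarrow> real"
  assumes "open S" "Ck_on k f S" "Ck_on k f' S"
  shows "Ck_on k (\<lambda>x. f x * f' x) S"
  using assms(2,3)
proof (induction k arbitrary: f f')
  case 0
  then show ?case by (simp add: continuous_on_mult)
next
  case (Suc k)
  show ?case
  proof (rule Ck_on_SucI[OF assms(1)])
    show "((\<lambda>x. f x * f' x) has_derivative
        (\<lambda>v. f x * frechet_derivative f' (at x) v + frechet_derivative f (at x) v * f' x)) (at x)"
      if "x \<in> S" for x
      using Suc.prems[THEN Ck_on_has_derivative, OF assms(1) that] by (rule has_derivative_mult)
    show "Ck_on k (\<lambda>x. f x * frechet_derivative f' (at x) v + frechet_derivative f (at x) v * f' x) S"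
      for v
      by (intro Ck_on_add assms(1) Suc.IH)
        (use Suc.prems Ck_on_SucD[OF Suc.prems(1)] Ck_on_SucD[OF Suc.prems(2)] in auto)
  qed
qed

section \<open>Vector fields and tensors\<close>

text \<open>
  A constant for the application of a vector field: a rewrite rule for \<open>X f\<close> with a variable
  \<open>X\<close> would match every application.
\<close>

definition der :: "'a vfield \<Rightarrow> ('a \<Rightarrow> real) \<Rightarrow> 'a \<Rightarrow> real" (infixr "\<rhd>" 75) where
  "X \<rhd> f = X f"

lemma der_simps [simp]:
  "(X + Y) \<rhd> f = X \<rhd> f + Y \<rhd> f"
  "(X - Y) \<rhd> f = X \<rhd> f - Y \<rhd> f"
  "(- X) \<rhd> f = - (X \<rhd> f)"
  "0 \<rhd> f = 0"
  "(k \<cdot> X) \<rhd> f = k * (X \<rhd> f)"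
  "(numeral m * X) \<rhd> f = numeral m * (X \<rhd> f)"
  "lie_bracket X Y \<rhd> f = X \<rhd> (Y \<rhd> f) - Y \<rhd> (X \<rhd> f)"
  by (simp_all add: der_def fscale_def lie_bracket_def fun_eq_iff)

lemma vfield_eqI: "(\<And>f p. (X \<rhd> f) p = (Y \<rhd> f) p) \<Longrightarrow> X = Y"
  by (simp add: der_def fun_eq_iff)

lemma fscale_0 [simp]: "0 \<cdot> X = 0" "f \<cdot> 0 = 0" and fscale_1 [simp]: "1 \<cdot> X = X"
  by (auto intro: vfield_eqI)

lemma uminus_eq_fscale: "- X = (\<lambda>_. -1) \<cdot> X"
  by (rule vfield_eqI) simp

lemma vfield_double_eqI:
  assumes "cscale 2 X = cscale 2 Y"
  shows "X = Y"
proof (rule vfield_eqI)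
  fix f p
  show "(X \<rhd> f) p = (Y \<rhd> f) p"
    using assms[THEN arg_cong[of _ _ "\<lambda>X. (X \<rhd> f) p"]] by simp
qed

locale manifold =
  fixes A :: "('a::{t2_space,second_countable_topology}, 'e::euclidean_space) atlas"
  assumes smooth_manifold: "smooth_manifold A"
begin

abbreviation "C \<equiv> smooth_functions A"
abbreviation "V \<equiv> vector_fields A"

lemma open_chart_image: "(U, \<psi>) \<in> A \<Longrightarrow> open (\<psi> ` U)"
  using smooth_manifold by (auto simp: smooth_manifold_def)

lemma C_const [simp]: "(\<lambda>p. c) \<in> C"
  by (auto simp: smooth_functions_def Cinf_on_def o_def intro!: Ck_on_const open_chart_image)

lemma C_0 [simp]: "0 \<in> C" and C_1 [simp]: "1 \<in> C"
  by (simp_all add: zero_fun_def one_fun_def)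

lemma C_add [simp]: "f \<in> C \<Longrightarrow> f' \<in> C \<Longrightarrow> f + f' \<in> C"
  by (auto simp: smooth_functions_def Cinf_on_def o_def plus_fun_def intro!: Ck_on_add
      dest: open_chart_image)

lemma C_mult [simp]: "f \<in> C \<Longrightarrow> f' \<in> C \<Longrightarrow> f * f' \<in> C"
  by (auto simp: smooth_functions_def Cinf_on_def o_def times_fun_def intro!: Ck_on_mult
      dest: open_chart_image)

lemma C_uminus [simp]: "f \<in> C \<Longrightarrow> - f \<in> C"
proof -
  have "- f = (\<lambda>_. -1) * f" by (simp add: fun_eq_iff)
  then show "f \<in> C \<Longrightarrow> - f \<in> C" by simp
qed

lemma C_diff [simp]: "f \<in> C \<Longrightarrow> f' \<in> C \<Longrightarrow> f - f' \<in> C"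
  using C_add[of f "- f'"] by simp

lemma V_nonsmooth: "X \<in> V \<Longrightarrow> f \<notin> C \<Longrightarrow> X f = 0"
  by (simp add: vector_fields_def)

text \<open>Homogeneity over constants follows from the Leibniz rule with a constant factor, once
  constants are sent to zero.\<close>

lemma V_I:
  assumes "\<And>f. f \<notin> C \<Longrightarrow> X f = 0" "\<And>f. f \<in> C \<Longrightarrow> X f \<in> C"
    "\<And>f f'. f \<in> C \<Longrightarrow> f' \<in> C \<Longrightarrow> X (f + f') = X f + X f'"
    "\<And>c. X (\<lambda>p. c) = 0"
    "\<And>f f'. f \<in> C \<Longrightarrow> f' \<in> C \<Longrightarrow> X (f * f') = f * X f' + X f * f'"
  shows "X \<in> V"
proof -
  have "X (\<lambda>p. c * f p) = (\<lambda>p. c * X f p)" if "f \<in> C" for c f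
    using assms(5)[OF C_const that, of c] assms(4)[of c] by (simp add: times_fun_def zero_fun_def)
  then show ?thesis using assms by (auto simp: vector_fields_def)
qed

lemma der_C [simp]: "X \<in> V \<Longrightarrow> f \<in> C \<Longrightarrow> X \<rhd> f \<in> C"
  and der_add [simp]: "X \<in> V \<Longrightarrow> f \<in> C \<Longrightarrow> f' \<in> C \<Longrightarrow> X \<rhd> (f + f') = X \<rhd> f + X \<rhd> f'"
  and der_mult [simp]: "X \<in> V \<Longrightarrow> f \<in> C \<Longrightarrow> f' \<in> C \<Longrightarrow> X \<rhd> (f * f') = f * (X \<rhd> f') + (X \<rhd> f) * f'"
  by (auto simp: vector_fields_def der_def)

text \<open>The Leibniz rule at \<open>1 = 1 * 1\<close> yields twice the same term, so
  \<open>X \<rhd> 1\<close> vanishes; homogeneity does the rest.\<close>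

lemma der_const [simp]: "X \<in> V \<Longrightarrow> X \<rhd> (\<lambda>p. c) = 0"
proof -
  assume X: "X \<in> V"
  have "\<forall>c. \<forall>f\<in>C. X (\<lambda>p. c * f p) = (\<lambda>p. c * X f p)"
    using X unfolding vector_fields_def by blast
  from bspec[OF spec[OF this] C_1, of c]
  have "X \<rhd> (\<lambda>p. c) = (\<lambda>p. c * (X \<rhd> 1) p)"
    by (simp add: der_def)
  moreover have "X \<rhd> 1 = 0"
    using der_mult[OF X C_1 C_1] by simp
  ultimately show ?thesis by (simp add: fun_eq_iff)
qed

lemma der_0 [simp]: "X \<in> V \<Longrightarrow> X \<rhd> 0 = 0"
  using der_const[of X 0] by (simp only: zero_fun_def)

lemma der_1 [simp]: "X \<in> V \<Longrightarrow> X \<rhd> 1 = 0"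
  using der_const[of X 1] by (simp only: one_fun_def)

lemma der_uminus [simp]: "X \<in> V \<Longrightarrow> f \<in> C \<Longrightarrow> X \<rhd> (- f) = - (X \<rhd> f)"
  using der_add[of X f "- f"] by (simp add: eq_neg_iff_add_eq_0 add.commute)

lemma der_diff [simp]: "X \<in> V \<Longrightarrow> f \<in> C \<Longrightarrow> f' \<in> C \<Longrightarrow> X \<rhd> (f - f') = X \<rhd> f - X \<rhd> f'"
  using der_add[of X f "- f'"] by simp

lemma V_I_der:
  assumes "\<And>f. f \<notin> C \<Longrightarrow> X \<rhd> f = 0" "\<And>f. f \<in> C \<Longrightarrow> X \<rhd> f \<in> C"
    "\<And>f f'. f \<in> C \<Longrightarrow> f' \<in> C \<Longrightarrow> X \<rhd> (f + f') = X \<rhd> f + X \<rhd> f'"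
    "\<And>c. X \<rhd> (\<lambda>p. c) = 0"
    "\<And>f f'. f \<in> C \<Longrightarrow> f' \<in> C \<Longrightarrow> X \<rhd> (f * f') = f * (X \<rhd> f') + (X \<rhd> f) * f'"
  shows "X \<in> V"
  using V_I[of X] assms by (simp add: der_def)

lemma der_nonsmooth [simp]: "X \<in> V \<Longrightarrow> f \<notin> C \<Longrightarrow> X \<rhd> f = 0"
  unfolding der_def by (rule V_nonsmooth)

lemma V_add [simp]: "X \<in> V \<Longrightarrow> Y \<in> V \<Longrightarrow> X + Y \<in> V"
  by (rule V_I_der) (auto simp: algebra_simps)

lemma V_fscale [simp]: "f \<in> C \<Longrightarrow> X \<in> V \<Longrightarrow> f \<cdot> X \<in> V"
  by (rule V_I_der) (auto simp: algebra_simps)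

lemma V_uminus [simp]: "X \<in> V \<Longrightarrow> - X \<in> V"
  by (rule V_I_der) (auto simp: algebra_simps)

lemma V_diff [simp]: "X \<in> V \<Longrightarrow> Y \<in> V \<Longrightarrow> X - Y \<in> V"
  by (rule V_I_der) (auto simp: algebra_simps)

lemma V_lie_bracket [simp]: "X \<in> V \<Longrightarrow> Y \<in> V \<Longrightarrow> lie_bracket X Y \<in> V"
  by (rule V_I_der) (auto simp: algebra_simps)

lemma V_0 [simp]: "0 \<in> V"
  by (rule V_I_der) auto

text \<open>Outside \<open>C\<close> both fields give zero by the convention for vector
  fields.\<close>

lemma V_eqI:
  assumes "X \<in> V" "Y \<in> V" "\<And>f. f \<in> C \<Longrightarrow> X \<rhd> f = Y \<rhd> f"
  shows "X = Y"
  using assms der_nonsmooth by (metis der_def ext)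

lemma lie_bracket_self [simp]: "lie_bracket X X = 0"
  by (simp add: vfield_eqI)

lemma lie_bracket_swap: "lie_bracket X Y = - lie_bracket Y X"
  by (simp add: vfield_eqI)

lemma lie_bracket_add [simp]:
  "X \<in> V \<Longrightarrow> Y \<in> V \<Longrightarrow> Z \<in> V \<Longrightarrow> lie_bracket X (Y + Z) = lie_bracket X Y + lie_bracket X Z"
  by (rule V_eqI) (auto simp: algebra_simps)

lemma lie_bracket_uminus [simp]:
  "X \<in> V \<Longrightarrow> Y \<in> V \<Longrightarrow> lie_bracket X (- Y) = - lie_bracket X Y"
  by (rule V_eqI) (auto simp: algebra_simps)

lemma lie_bracket_diff [simp]:
  "X \<in> V \<Longrightarrow> Y \<in> V \<Longrightarrow> Z \<in> V \<Longrightarrow> lie_bracket X (Y - Z) = lie_bracket X Y - lie_bracket X Z"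
  by (rule V_eqI) (auto simp: algebra_simps)

lemma lie_bracket_fscale [simp]:
  "X \<in> V \<Longrightarrow> Y \<in> V \<Longrightarrow> f \<in> C \<Longrightarrow> lie_bracket X (f \<cdot> Y) = f \<cdot> lie_bracket X Y + (X \<rhd> f) \<cdot> Y"
  by (rule V_eqI) (auto simp: algebra_simps)

lemma jacobi:
  "X \<in> V \<Longrightarrow> Y \<in> V \<Longrightarrow> Z \<in> V \<Longrightarrow>
   lie_bracket (lie_bracket X Y) Z + lie_bracket (lie_bracket Y Z) X + lie_bracket (lie_bracket Z X) Y = 0"
  by (rule V_eqI) (auto simp: algebra_simps)

lemma one_formD:
  assumes "one_form A \<alpha>"
  shows "X \<in> V \<Longrightarrow> \<alpha> X \<in> C"
    "X \<in> V \<Longrightarrow> Y \<in> V \<Longrightarrow> \<alpha> (X + Y) = \<alpha> X + \<alpha> Y"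
    "f \<in> C \<Longrightarrow> X \<in> V \<Longrightarrow> \<alpha> (f \<cdot> X) = f * \<alpha> X"
    "\<alpha> 0 = 0"
    "X \<in> V \<Longrightarrow> \<alpha> (- X) = - \<alpha> X"
    "X \<in> V \<Longrightarrow> Y \<in> V \<Longrightarrow> \<alpha> (X - Y) = \<alpha> X - \<alpha> Y"
proof -
  show 1: "X \<in> V \<Longrightarrow> \<alpha> X \<in> C" "X \<in> V \<Longrightarrow> Y \<in> V \<Longrightarrow> \<alpha> (X + Y) = \<alpha> X + \<alpha> Y"
    "f \<in> C \<Longrightarrow> X \<in> V \<Longrightarrow> \<alpha> (f \<cdot> X) = f * \<alpha> X" for X Y f
    using assms by (auto simp: one_form_def)
  show 2: "\<alpha> 0 = 0"
    using 1(2)[of 0 0] by simp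
  show 3: "X \<in> V \<Longrightarrow> \<alpha> (- X) = - \<alpha> X" for X
    using 1(2)[of X "- X"] 2 by (simp add: eq_neg_iff_add_eq_0 add.commute)
  show "X \<in> V \<Longrightarrow> Y \<in> V \<Longrightarrow> \<alpha> (X - Y) = \<alpha> X - \<alpha> Y"
    using 1(2)[of X "- Y"] 3[of Y] by simp
qed

lemma tensor_11D:
  assumes "tensor_field_11 A T"
  shows "X \<in> V \<Longrightarrow> T X \<in> V"
    "X \<in> V \<Longrightarrow> Y \<in> V \<Longrightarrow> T (X + Y) = T X + T Y"
    "f \<in> C \<Longrightarrow> X \<in> V \<Longrightarrow> T (f \<cdot> X) = f \<cdot> T X"
    "T 0 = 0"
    "X \<in> V \<Longrightarrow> T (- X) = - T X"
    "X \<in> V \<Longrightarrow> Y \<in> V \<Longrightarrow> T (X - Y) = T X - T Y"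
proof -
  show 1: "X \<in> V \<Longrightarrow> T X \<in> V" "X \<in> V \<Longrightarrow> Y \<in> V \<Longrightarrow> T (X + Y) = T X + T Y"
    "f \<in> C \<Longrightarrow> X \<in> V \<Longrightarrow> T (f \<cdot> X) = f \<cdot> T X" for X Y f
    using assms by (auto simp: tensor_field_11_def)
  show 2: "T 0 = 0"
    using 1(2)[of 0 0] by simp
  show 3: "X \<in> V \<Longrightarrow> T (- X) = - T X" for X
    using 1(2)[of X "- X"] 2 by (simp add: eq_neg_iff_add_eq_0 add.commute)
  show "X \<in> V \<Longrightarrow> Y \<in> V \<Longrightarrow> T (X - Y) = T X - T Y"
    using 1(2)[of X "- Y"] 3[of Y] by simp
qed

end


section \<open>Contact metric structures\<close>

lemma double_eqI:
  fixes u v :: "'b \<Rightarrow> real"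
  shows "(\<lambda>_. 2) * u = (\<lambda>_. 2) * v \<Longrightarrow> u = v"
  by (simp add: fun_eq_iff)

locale contact_metric = manifold A
  for A :: "('a::{t2_space,second_countable_topology}, 'e::euclidean_space) atlas" +
  fixes n :: nat
    and \<phi> :: "'a vfield \<Rightarrow> 'a vfield"
    and \<xi> :: "'a vfield"
    and \<eta> :: "'a vfield \<Rightarrow> 'a \<Rightarrow> real"
    and g :: "'a vfield \<Rightarrow> 'a vfield \<Rightarrow> 'a \<Rightarrow> real"
  assumes contact_metric: "contact_metric_structure A n \<phi> \<xi> \<eta> g"
begin

abbreviation "h \<equiv> h_tensor \<phi> \<xi>"
definition "B X = \<phi> (h X)"

lemma contact_manifold: "contact_manifold A n \<eta>"
  and reeb_field: "reeb_field A \<eta> \<xi>"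
  and metric: "riemannian_metric A g"
  and eta_form: "one_form A \<eta>"
  and phi_tensor: "tensor_field_11 A \<phi>"
  using contact_metric by (auto simp: contact_metric_structure_def contact_manifold_def)

lemmas eta_simps [simp] = one_formD[OF eta_form]
lemmas phi_simps [simp] = tensor_11D[OF phi_tensor]

lemma xi_V [simp]: "\<xi> \<in> V" and eta_xi [simp]: "\<eta> \<xi> = 1"
  using reeb_field by (auto simp: reeb_field_def)

lemma g_sym: "X \<in> V \<Longrightarrow> Y \<in> V \<Longrightarrow> g X Y = g Y X"
  and g_form: "X \<in> V \<Longrightarrow> one_form A (g X)"
  and g_pos: "X \<in> V \<Longrightarrow> nonzero_at A X p \<Longrightarrow> g X X p > 0"
  using metric by (auto simp: riemannian_metric_def)

lemma g_right [simp]: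
  assumes "X \<in> V"
  shows "Y \<in> V \<Longrightarrow> g X Y \<in> C"
    "Y \<in> V \<Longrightarrow> Z \<in> V \<Longrightarrow> g X (Y + Z) = g X Y + g X Z"
    "f \<in> C \<Longrightarrow> Y \<in> V \<Longrightarrow> g X (f \<cdot> Y) = f * g X Y"
    "g X 0 = 0"
    "Y \<in> V \<Longrightarrow> g X (- Y) = - g X Y"
    "Y \<in> V \<Longrightarrow> Z \<in> V \<Longrightarrow> g X (Y - Z) = g X Y - g X Z"
  using one_formD[OF g_form[OF assms]] by auto

lemma g_left [simp]:
  assumes "X \<in> V"
  shows "Y \<in> V \<Longrightarrow> Z \<in> V \<Longrightarrow> g (Y + Z) X = g Y X + g Z X"
    "f \<in> C \<Longrightarrow> Y \<in> V \<Longrightarrow> g (f \<cdot> Y) X = f * g Y X"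
    "g 0 X = 0"
    "Y \<in> V \<Longrightarrow> g (- Y) X = - g Y X"
    "Y \<in> V \<Longrightarrow> Z \<in> V \<Longrightarrow> g (Y - Z) X = g Y X - g Z X"
  using assms by (simp_all add: g_sym[of _ X])

text \<open>Positivity is applied to \<open>X - Y\<close> itself: its square under \<open>g\<close>
  vanishes at every point, so \<open>X - Y\<close> is nonzero nowhere.\<close>

lemma nondegenerate:
  assumes "X \<in> V" "Y \<in> V" "\<And>Z. Z \<in> V \<Longrightarrow> g X Z = g Y Z"
  shows "X = Y"
proof -
  have "g (X - Y) (X - Y) p = 0" for p
    using assms by simp
  then have "\<not> nonzero_at A (X - Y) p" for p
    using g_pos[of "X - Y" p] assms by auto
  then have "(X - Y) f p = 0" if "f \<in> C" for f p
    using that by (auto simp: nonzero_at_def)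
  then show ?thesis
    by (intro V_eqI assms) (auto simp: der_def fun_eq_iff)
qed

lemma phi_phi [simp]: "X \<in> V \<Longrightarrow> \<phi> (\<phi> X) = - X + \<eta> X \<cdot> \<xi>"
  and d_eta: "X \<in> V \<Longrightarrow> Y \<in> V \<Longrightarrow> ext_deriv \<eta> X Y = g X (\<phi> Y)"
  and g_phi_phi: "X \<in> V \<Longrightarrow> Y \<in> V \<Longrightarrow> g (\<phi> X) (\<phi> Y) = g X Y - \<eta> X * \<eta> Y"
  using contact_metric by (auto simp: contact_metric_structure_def)

lemma two_g_phi:
  "X \<in> V \<Longrightarrow> Y \<in> V \<Longrightarrow>
   (\<lambda>_. 2) * g X (\<phi> Y) = X \<rhd> \<eta> Y - Y \<rhd> \<eta> X - \<eta> (lie_bracket X Y)"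
  by (simp add: d_eta[symmetric] ext_deriv_def der_def fun_eq_iff)

text \<open>This is the skew-symmetry of \<open>d\<eta>\<close>.\<close>

lemma phi_skew: "X \<in> V \<Longrightarrow> Y \<in> V \<Longrightarrow> g X (\<phi> Y) = - g (\<phi> X) Y"
proof -
  assume XY: "X \<in> V" "Y \<in> V"
  have "(\<lambda>_. 2) * g X (\<phi> Y) = - ((\<lambda>_. 2) * g Y (\<phi> X))"
    using XY by (subst (1 2) two_g_phi) (simp_all add: lie_bracket_swap[of Y X])
  then show ?thesis
    using XY by (simp add: fun_eq_iff g_sym[of Y "\<phi> X"])
qed

lemma g_xi_phi [simp]: "X \<in> V \<Longrightarrow> g \<xi> (\<phi> X) = 0"
  using reeb_field d_eta[of \<xi> X] by (auto simp: reeb_field_def)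

lemma g_phi_xi [simp]: "X \<in> V \<Longrightarrow> g X (\<phi> \<xi>) = 0"
  using phi_skew[of X \<xi>] g_sym[of "\<phi> X" \<xi>] by simp

lemma phi_xi [simp]: "\<phi> \<xi> = 0"
  by (rule nondegenerate) (simp_all add: g_sym[of "\<phi> \<xi>"])

lemma g_xi_right [simp]: "X \<in> V \<Longrightarrow> g X \<xi> = \<eta> X"
  using g_phi_phi[of X \<xi>] by (simp add: fun_eq_iff)

lemma g_xi_left [simp]: "X \<in> V \<Longrightarrow> g \<xi> X = \<eta> X"
  by (simp add: g_sym[of \<xi>])

lemma eta_phi [simp]: "X \<in> V \<Longrightarrow> \<eta> (\<phi> X) = 0"
  using g_xi_left[of "\<phi> X"] g_xi_phi[of X] by simp

text \<open>The Reeb flow preserves \<eta>: the condition on \<open>d\<eta>\<close> and the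
  constancy of \<open>\<eta> \<xi>\<close> give \<open>L\<^sub>\<xi> \<eta> = 0\<close>.\<close>

lemma eta_bracket_xi [simp]: "X \<in> V \<Longrightarrow> \<eta> (lie_bracket \<xi> X) = \<xi> \<rhd> \<eta> X"
  using two_g_phi[of \<xi> X] by (simp add: fun_eq_iff)

section \<open>The algebra of \<open>h\<close> and \<open>B\<close>\<close>

lemma tensor_h: "tensor_field_11 A h"
  unfolding tensor_field_11_def h_tensor_def lie_deriv_11_def
  by (auto intro!: vfield_eqI simp: algebra_simps)

lemmas h_simps [simp] = tensor_11D[OF tensor_h]

text \<open>The definition of \<open>h\<close> solved for the bracket, so that \<phi> can be pulled
  out of brackets with \<xi>.\<close>

lemma bracket_phi:
  "X \<in> V \<Longrightarrow> lie_bracket \<xi> (\<phi> X) = \<phi> (lie_bracket \<xi> X) + cscale 2 (h X)"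
  by (rule vfield_eqI) (simp add: h_tensor_def lie_deriv_11_def field_simps)

lemma h_xi [simp]: "h \<xi> = 0"
  by (rule vfield_eqI) (simp add: h_tensor_def lie_deriv_11_def)

lemma eta_h [simp]: "X \<in> V \<Longrightarrow> \<eta> (h X) = 0"
  by (simp add: h_tensor_def lie_deriv_11_def)

lemma tensor_B: "tensor_field_11 A B"
  unfolding tensor_field_11_def B_def by simp

lemmas B_simps [simp] = tensor_11D[OF tensor_B]

lemma phi_h [simp]: "X \<in> V \<Longrightarrow> \<phi> (h X) = B X"
  by (simp add: B_def)

lemma B_xi [simp]: "B \<xi> = 0"
  and eta_B [simp]: "X \<in> V \<Longrightarrow> \<eta> (B X) = 0"
  by (simp_all add: B_def del: phi_h)

lemma phi_B [simp]: "X \<in> V \<Longrightarrow> \<phi> (B X) = - h X"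
  by (simp add: B_def del: phi_h)

text \<open>This is \<open>L\<^sub>\<xi>(\<phi>\<^sup>2) = 0\<close>.\<close>

lemma h_phi [simp]:
  assumes "X \<in> V"
  shows "h (\<phi> X) = - B X"
proof -
  have "lie_bracket \<xi> (\<phi> (\<phi> X)) = \<phi> (lie_bracket \<xi> (\<phi> X)) + cscale 2 (h (\<phi> X))"
    using assms by (simp add: bracket_phi del: phi_phi)
  then have "lie_bracket \<xi> (\<phi> (\<phi> X)) = \<phi> (\<phi> (lie_bracket \<xi> X)) + cscale 2 (B X + h (\<phi> X))"
    using assms
    by (intro vfield_eqI) (simp add: bracket_phi algebra_simps del: phi_phi)
  then have "cscale 2 (B X + h (\<phi> X)) = 0"
    using assms by simp
  then have *: "(cscale 2 (B X + h (\<phi> X)) \<rhd> f) p = 0" for f p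
    by simp
  show ?thesis
    by (rule vfield_eqI) (use * in \<open>simp add: add_eq_0_iff2\<close>)
qed

lemma B_phi [simp]: "X \<in> V \<Longrightarrow> B (\<phi> X) = h X"
  unfolding B_def by simp

text \<open>This is \<open>d(d\<eta>) = 0\<close> with \<open>d\<eta>\<close> written through
  \<open>g\<close> and \<phi>. After doubling, the second derivatives of \<eta> agree on both sides
  and the double brackets cancel by \<open>jacobi\<close>.\<close>

lemma closed:
  assumes "X \<in> V" "Y \<in> V" "Z \<in> V"
  shows "X \<rhd> g Y (\<phi> Z) + Y \<rhd> g Z (\<phi> X) + Z \<rhd> g X (\<phi> Y) =
    g (lie_bracket X Y) (\<phi> Z) + g (lie_bracket Y Z) (\<phi> X) + g (lie_bracket Z X) (\<phi> Y)"
proof -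
  have d: "(\<lambda>_. 2) * (W \<rhd> g U (\<phi> U')) =
      W \<rhd> (U \<rhd> \<eta> U') - W \<rhd> (U' \<rhd> \<eta> U) - W \<rhd> \<eta> (lie_bracket U U')"
    if "W \<in> V" "U \<in> V" "U' \<in> V" for W U U'
  proof -
    have "(\<lambda>_. 2) * (W \<rhd> g U (\<phi> U')) = W \<rhd> ((\<lambda>_. 2) * g U (\<phi> U'))"
      using that by simp
    then show ?thesis
      using that by (simp add: two_g_phi)
  qed
  have "\<eta> (lie_bracket (lie_bracket X Y) Z) + \<eta> (lie_bracket (lie_bracket Y Z) X)
      + \<eta> (lie_bracket (lie_bracket Z X) Y) = 0"
    using assms jacobi[OF assms, THEN arg_cong[of _ _ \<eta>]] by simp
  then have j: "\<eta> (lie_bracket (lie_bracket X Y) Z) =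
      - \<eta> (lie_bracket (lie_bracket Y Z) X) - \<eta> (lie_bracket (lie_bracket Z X) Y)"
    by (simp add: algebra_simps eq_neg_iff_add_eq_0)
  have "(\<lambda>_. 2) * (X \<rhd> g Y (\<phi> Z) + Y \<rhd> g Z (\<phi> X) + Z \<rhd> g X (\<phi> Y)) =
    (\<lambda>_. 2) * (g (lie_bracket X Y) (\<phi> Z) + g (lie_bracket Y Z) (\<phi> X) + g (lie_bracket Z X) (\<phi> Y))"
    using assms
    by (simp add: distrib_left d two_g_phi) (simp add: j algebra_simps)
  then show ?thesis
    by (rule double_eqI)
qed

text \<open>The left side is \<open>(L\<^sub>\<xi> g)(X, \<phi> Y)\<close>. Closedness with first
  argument \<xi> says \<open>L\<^sub>\<xi> d\<eta> = 0\<close>, so only the contribution of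
  \<open>L\<^sub>\<xi> \<phi> = 2h\<close> remains.\<close>

lemma lie_metric_phi:
  assumes "X \<in> V" "Y \<in> V"
  shows "\<xi> \<rhd> g X (\<phi> Y) - g (lie_bracket \<xi> X) (\<phi> Y) - g X (lie_bracket \<xi> (\<phi> Y)) =
    (\<lambda>_. -2) * g X (h Y)"
  using closed[of \<xi> X Y] assms phi_skew[of "lie_bracket Y \<xi>" X]
  by (simp add: bracket_phi lie_bracket_swap[of Y \<xi>] g_sym[of _ "\<phi> X"] g_sym[of _ X]
      phi_skew fun_eq_iff algebra_simps)

lemma lie_metric:
  assumes "X \<in> V" "Y \<in> V"
  shows "\<xi> \<rhd> g X Y - g (lie_bracket \<xi> X) Y - g X (lie_bracket \<xi> Y) =
    (\<lambda>_. -2) * g X (B Y)"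
  using lie_metric_phi[of X "\<phi> Y"] assms
  by (simp add: fun_eq_iff algebra_simps)

text \<open>Up to the factor -2 this bilinear form is \<open>L\<^sub>\<xi> g\<close> by
  \<open>lie_metric\<close>, and a Lie derivative of \<open>g\<close> is symmetric.\<close>

lemma g_B:
  assumes "X \<in> V" "Y \<in> V"
  shows "g X (B Y) = g (B X) Y"
proof
  fix p
  show "g X (B Y) p = g (B X) Y p"
    using lie_metric[of X Y, THEN fun_cong, of p] lie_metric[of Y X, THEN fun_cong, of p] assms
    by (simp add: g_sym[of Y] g_sym[of "lie_bracket \<xi> Y"])
qed

lemma g_h:
  assumes "X \<in> V" "Y \<in> V"
  shows "g X (h Y) = g (h X) Y"
proof -
  have "g X (h Y) = - g X (\<phi> (B Y))" "g (h X) Y = g (B (\<phi> X)) Y"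
    using assms by simp_all
  then show ?thesis
    using assms by (simp add: phi_skew g_B del: phi_B B_phi)
qed

end


section \<open>The structure tensor h\<close>

locale kappa_mu = contact_metric A n \<phi> \<xi> \<eta> g
  for A :: "('a::{t2_space,second_countable_topology}, 'e::euclidean_space) atlas"
    and n :: nat
    and \<phi> :: "'a vfield \<Rightarrow> 'a vfield"
    and \<xi> :: "'a vfield"
    and \<eta> :: "'a vfield \<Rightarrow> 'a \<Rightarrow> real"
    and g :: "'a vfield \<Rightarrow> 'a vfield \<Rightarrow> 'a \<Rightarrow> real" +
  fixes D :: "'a vfield \<Rightarrow> 'a vfield \<Rightarrow> 'a vfield"
    and \<kappa> \<mu> :: real
  assumes levi_civita: "levi_civita_connection A g D"
    and nullity: "X \<in> V \<Longrightarrow> Y \<in> V \<Longrightarrow> curvature D X Y \<xi> =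
      cscale \<kappa> (\<eta> Y \<cdot> X - \<eta> X \<cdot> Y) +
      cscale \<mu> (\<eta> Y \<cdot> h_tensor \<phi> \<xi> X - \<eta> X \<cdot> h_tensor \<phi> \<xi> Y)"
begin

lemma D_V [simp]: "X \<in> V \<Longrightarrow> Y \<in> V \<Longrightarrow> D X Y \<in> V"
  and D_add_left [simp]: "X \<in> V \<Longrightarrow> Y \<in> V \<Longrightarrow> Z \<in> V \<Longrightarrow> D (X + Y) Z = D X Z + D Y Z"
  and D_fscale_left [simp]: "f \<in> C \<Longrightarrow> X \<in> V \<Longrightarrow> Y \<in> V \<Longrightarrow> D (f \<cdot> X) Y = f \<cdot> D X Y"
  and D_add_right [simp]: "X \<in> V \<Longrightarrow> Y \<in> V \<Longrightarrow> Z \<in> V \<Longrightarrow> D X (Y + Z) = D X Y + D X Z"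
  and D_fscale_right [simp]:
    "f \<in> C \<Longrightarrow> X \<in> V \<Longrightarrow> Y \<in> V \<Longrightarrow> D X (f \<cdot> Y) = (X \<rhd> f) \<cdot> Y + f \<cdot> D X Y"
  and torsion_free: "X \<in> V \<Longrightarrow> Y \<in> V \<Longrightarrow> D X Y - D Y X = lie_bracket X Y"
  and D_metric:
    "X \<in> V \<Longrightarrow> Y \<in> V \<Longrightarrow> Z \<in> V \<Longrightarrow> X \<rhd> g Y Z = g (D X Y) Z + g Y (D X Z)"
  using levi_civita unfolding levi_civita_connection_def der_def by blast+

lemma D_uminus_left [simp]: "X \<in> V \<Longrightarrow> Y \<in> V \<Longrightarrow> D (- X) Y = - D X Y"
  unfolding uminus_eq_fscale by simp

lemma D_uminus_right [simp]: "X \<in> V \<Longrightarrow> Y \<in> V \<Longrightarrow> D X (- Y) = - D X Y"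
  unfolding uminus_eq_fscale by simp

lemma D_diff_left [simp]: "X \<in> V \<Longrightarrow> Y \<in> V \<Longrightarrow> Z \<in> V \<Longrightarrow> D (X - Y) Z = D X Z - D Y Z"
  using D_add_left[of X "- Y" Z] by simp

lemma D_diff_right [simp]: "X \<in> V \<Longrightarrow> Y \<in> V \<Longrightarrow> Z \<in> V \<Longrightarrow> D X (Y - Z) = D X Y - D X Z"
  using D_add_right[of X Y "- Z"] by simp

lemma D_0 [simp]: "X \<in> V \<Longrightarrow> D X 0 = 0" "X \<in> V \<Longrightarrow> D 0 X = 0"
  using D_diff_right[of X 0 0] D_diff_left[of 0 0 X] by simp_all

lemma g_D_xi: "X \<in> V \<Longrightarrow> Y \<in> V \<Longrightarrow> g (D X \<xi>) Y = X \<rhd> \<eta> Y - \<eta> (D X Y)"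
  using D_metric[of X \<xi> Y] by simp

text \<open>The skew part of \<open>D \<xi>\<close> is given by \<open>d\<eta>\<close>, the
  symmetric part by \<open>L\<^sub>\<xi> g\<close>, which \<open>lie_metric\<close>
  computes.\<close>

lemma D_xi [simp]:
  assumes "X \<in> V"
  shows "D X \<xi> = - \<phi> X - B X"
proof (rule nondegenerate)
  fix Z assume Z: "Z \<in> V"
  have "g (D X \<xi>) Z - g (D Z \<xi>) X = (\<lambda>_. 2) * g X (\<phi> Z)"
    using assms Z by (simp add: g_D_xi two_g_phi flip: torsion_free)
  moreover have "g (D X \<xi>) Z + g (D Z \<xi>) X = (\<lambda>_. -2) * g X (B Z)"
  proof -
    have "D X \<xi> = D \<xi> X - lie_bracket \<xi> X" "D Z \<xi> = D \<xi> Z - lie_bracket \<xi> Z"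
      using assms Z by (simp_all flip: torsion_free)
    then have e: "g (D X \<xi>) Z = g (D \<xi> X) Z - g (lie_bracket \<xi> X) Z"
      "g (D Z \<xi>) X = g X (D \<xi> Z) - g X (lie_bracket \<xi> Z)"
      using assms Z by (simp_all add: g_sym[of X])
    show ?thesis
    proof
      fix p
      show "(g (D X \<xi>) Z + g (D Z \<xi>) X) p = ((\<lambda>_. -2) * g X (B Z)) p"
        using e[THEN fun_cong, of p] lie_metric[OF assms Z, THEN fun_cong, of p]
          D_metric[OF xi_V assms Z, THEN fun_cong, of p] by simp
    qed
  qed
  ultimately show "g (D X \<xi>) Z = g (- \<phi> X - B X) Z"
    using assms Z by (simp add: fun_eq_iff phi_skew g_B) (smt (verit))
qed (use assms in simp_all)

lemma D_xi_left: "X \<in> V \<Longrightarrow> D \<xi> X = lie_bracket \<xi> X - \<phi> X - B X"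
  using torsion_free[of \<xi> X] by (simp add: algebra_simps)

lemma bracket_B:
  "X \<in> V \<Longrightarrow> lie_bracket \<xi> (B X) = \<phi> (lie_bracket \<xi> (h X)) + cscale 2 (h (h X))"
  using bracket_phi[of "h X"] by simp

lemma h_B [simp]: "X \<in> V \<Longrightarrow> h (B X) = - B (h X)"
  using h_phi[of "h X"] by simp

lemma B_B [simp]: "X \<in> V \<Longrightarrow> B (B X) = h (h X)"
  unfolding B_def by simp

section \<open>The Lie derivative of \<open>h\<close> along \<xi> and the square of
  \<open>h\<close>\<close>

definition "lie_h X = lie_bracket \<xi> (h X) - h (lie_bracket \<xi> X)"

lemma lie_h_V [simp]: "X \<in> V \<Longrightarrow> lie_h X \<in> V"
  and eta_lie_h [simp]: "X \<in> V \<Longrightarrow> \<eta> (lie_h X) = 0"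
  by (simp_all add: lie_h_def)

text \<open>The nullity condition for \<open>R(X, \<xi>)\<xi>\<close>.\<close>

lemma phi_lie_h:
  assumes "X \<in> V"
  shows "\<phi> (lie_h X) = cscale (\<kappa> - 1) (X - \<eta> X \<cdot> \<xi>) + cscale (\<mu> - 2) (h X) - h (h X)"
proof -
  have "curvature D X \<xi> \<xi> = cscale 2 (h X) + h (h X) - \<phi> (\<phi> X) + \<phi> (lie_h X)"
    unfolding curvature_def lie_h_def using assms
    by (intro vfield_eqI)
      (simp add: D_xi_left bracket_phi bracket_B lie_bracket_swap[of X \<xi>] algebra_simps)
  then have "cscale 2 (h X) + h (h X) - \<phi> (\<phi> X) + \<phi> (lie_h X) =
      cscale \<kappa> (X - \<eta> X \<cdot> \<xi>) + cscale \<mu> (h X)"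
    using assms nullity[of X \<xi>] by simp
  note * = this[THEN arg_cong[of _ _ "\<lambda>X. (X \<rhd> f) p" for f p]]
  show ?thesis
    by (rule vfield_eqI) (use * assms in \<open>simp add: algebra_simps\<close>)
qed

text \<open>The values of \<open>lie_h\<close> lie in the kernel of \<eta>, where
  \<open>- \<phi>\<^sup>2\<close> is the identity; hence \<open>phi_lie_h\<close> can be solved for
  \<open>lie_h\<close>.\<close>

lemma lie_h_eq:
  assumes "X \<in> V"
  shows "lie_h X = cscale (1 - \<kappa>) (\<phi> X) + cscale (2 - \<mu>) (B X) + B (h X)"
proof -
  have "lie_h X = - \<phi> (\<phi> (lie_h X))"
    using assms by simp
  also have "\<dots> = cscale (1 - \<kappa>) (\<phi> X) + cscale (2 - \<mu>) (B X) + B (h X)"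
    using assms by (intro vfield_eqI) (simp add: phi_lie_h algebra_simps del: phi_phi)
  finally show ?thesis .
qed

text \<open>The Lie derivative along \<xi> of \<open>h \<phi> + \<phi> h = 0\<close>; each of the
  two products contributes \<open>2 h\<^sup>2\<close>.\<close>

lemma lie_h_phi:
  assumes "X \<in> V"
  shows "lie_h (\<phi> X) = - \<phi> (lie_h X) - cscale 4 (h (h X))"
  unfolding lie_h_def using assms
  by (intro vfield_eqI) (simp add: bracket_phi bracket_B)

text \<open>Inserting \<open>lie_h_eq\<close> and \<open>phi_lie_h\<close> into
  \<open>lie_h_phi\<close> cancels the terms with \<mu> and leaves an equation for twice the square
  of \<open>h\<close>.\<close>

lemma h_h [simp]:
  assumes "X \<in> V"
  shows "h (h X) = cscale (1 - \<kappa>) (X - \<eta> X \<cdot> \<xi>)"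
proof (rule vfield_double_eqI, rule vfield_eqI)
  fix f p
  show "(cscale 2 (h (h X)) \<rhd> f) p = (cscale 2 (cscale (1 - \<kappa>) (X - \<eta> X \<cdot> \<xi>)) \<rhd> f) p"
    using lie_h_phi[OF assms, THEN arg_cong[of _ _ "\<lambda>X. (X \<rhd> f) p"]] assms
    by (simp add: lie_h_eq phi_lie_h algebra_simps)
qed

lemma B_h [simp]: "X \<in> V \<Longrightarrow> B (h X) = cscale (1 - \<kappa>) (\<phi> X)"
  unfolding B_def by simp

end


section \<open>Covariant derivatives of the structure tensors\<close>

context kappa_mu
begin

definition "dphi X Y = D X (\<phi> Y) - \<phi> (D X Y)"
definition "dB X Y = D X (B Y) - B (D X Y)"

lemma dphi_V [simp]: "X \<in> V \<Longrightarrow> Y \<in> V \<Longrightarrow> dphi X Y \<in> V"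
  and dB_V [simp]: "X \<in> V \<Longrightarrow> Y \<in> V \<Longrightarrow> dB X Y \<in> V"
  by (simp_all add: dphi_def dB_def)

lemma dphi_linear [simp]:
  "X \<in> V \<Longrightarrow> Y \<in> V \<Longrightarrow> dphi (- X) Y = - dphi X Y"
  "X \<in> V \<Longrightarrow> Y \<in> V \<Longrightarrow> dphi X (- Y) = - dphi X Y"
  "X \<in> V \<Longrightarrow> Y \<in> V \<Longrightarrow> Z \<in> V \<Longrightarrow> dphi (X - Y) Z = dphi X Z - dphi Y Z"
  "X \<in> V \<Longrightarrow> Y \<in> V \<Longrightarrow> Z \<in> V \<Longrightarrow> dphi X (Y - Z) = dphi X Y - dphi X Z"
  "f \<in> C \<Longrightarrow> X \<in> V \<Longrightarrow> Y \<in> V \<Longrightarrow> dphi (f \<cdot> X) Y = f \<cdot> dphi X Y"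
  "f \<in> C \<Longrightarrow> X \<in> V \<Longrightarrow> Y \<in> V \<Longrightarrow> dphi X (f \<cdot> Y) = f \<cdot> dphi X Y"
  by (auto intro!: vfield_eqI simp: dphi_def algebra_simps)

lemma dB_linear [simp]:
  "X \<in> V \<Longrightarrow> Y \<in> V \<Longrightarrow> dB (- X) Y = - dB X Y"
  "X \<in> V \<Longrightarrow> Y \<in> V \<Longrightarrow> dB X (- Y) = - dB X Y"
  "X \<in> V \<Longrightarrow> Y \<in> V \<Longrightarrow> Z \<in> V \<Longrightarrow> dB (X - Y) Z = dB X Z - dB Y Z"
  "X \<in> V \<Longrightarrow> Y \<in> V \<Longrightarrow> Z \<in> V \<Longrightarrow> dB X (Y - Z) = dB X Y - dB X Z"
  "f \<in> C \<Longrightarrow> X \<in> V \<Longrightarrow> Y \<in> V \<Longrightarrow> dB (f \<cdot> X) Y = f \<cdot> dB X Y"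
  "f \<in> C \<Longrightarrow> X \<in> V \<Longrightarrow> Y \<in> V \<Longrightarrow> dB X (f \<cdot> Y) = f \<cdot> dB X Y"
  by (auto intro!: vfield_eqI simp: dB_def algebra_simps)

lemma dphi_xi_right [simp]: "X \<in> V \<Longrightarrow> dphi X \<xi> = \<eta> X \<cdot> \<xi> - X - h X"
  unfolding dphi_def by (rule vfield_eqI) simp

text \<open>The term \<open>2h\<close> from \<open>bracket_phi\<close> cancels against the
  commutator of \<open>B\<close> and \<phi>.\<close>

lemma dphi_xi_left [simp]: "X \<in> V \<Longrightarrow> dphi \<xi> X = 0"
  unfolding dphi_def by (rule vfield_eqI) (simp add: D_xi_left bracket_phi)

lemma dB_xi_right [simp]:
  "X \<in> V \<Longrightarrow> dB X \<xi> = h X + cscale (1 - \<kappa>) (X - \<eta> X \<cdot> \<xi>)"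
  unfolding dB_def by (rule vfield_eqI) simp

lemma dB_xi_left [simp]:
  assumes "X \<in> V"
  shows "dB \<xi> X = cscale \<mu> (h X)"
proof (rule vfield_eqI)
  fix f p
  show "(dB \<xi> X \<rhd> f) p = (cscale \<mu> (h X) \<rhd> f) p"
    using phi_lie_h[OF assms, THEN arg_cong[of _ _ "\<lambda>X. (X \<rhd> f) p"]] assms
    by (simp add: dB_def lie_h_def D_xi_left bracket_B algebra_simps)
qed

lemma phi_swap: "X \<in> V \<Longrightarrow> Y \<in> V \<Longrightarrow> g (\<phi> X) Y = - g (\<phi> Y) X"
  using phi_skew[of Y X] g_sym[of Y "\<phi> X"] by simp

lemma dphi_skew:
  assumes "X \<in> V" "Y \<in> V" "Z \<in> V"
  shows "g (dphi X Y) Z = - g (dphi X Z) Y"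
proof
  fix p
  show "g (dphi X Y) Z p = (- g (dphi X Z) Y) p"
    using D_metric[of X Y "\<phi> Z", THEN fun_cong, of p]
      D_metric[of X "\<phi> Y" Z, THEN fun_cong, of p]
      phi_swap[of Y "D X Z", THEN fun_cong, of p] assms
    by (simp add: dphi_def phi_skew g_sym[of Y])
qed

lemma dB_sym:
  assumes "X \<in> V" "Y \<in> V" "Z \<in> V"
  shows "g (dB X Y) Z = g (dB X Z) Y"
proof
  fix p
  show "g (dB X Y) Z p = g (dB X Z) Y p"
    using D_metric[of X Y "B Z", THEN fun_cong, of p] D_metric[of X "B Y" Z, THEN fun_cong, of p]
      g_B[of "D X Z" Y, THEN fun_cong, of p] g_sym[of "D X Z" "B Y"] assms
    by (simp add: dB_def g_B g_sym[of Y])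
qed

text \<open>This is \<open>closed\<close> again, with derivatives expanded by
  \<open>D_metric\<close> and brackets by \<open>torsion_free\<close>.\<close>

lemma dphi_cyclic:
  assumes "X \<in> V" "Y \<in> V" "Z \<in> V"
  shows "g (dphi X Y) Z + g (dphi Y Z) X + g (dphi Z X) Y = 0"
proof
  fix p
  show "(g (dphi X Y) Z + g (dphi Y Z) X + g (dphi Z X) Y) p = 0 p"
    using assms closed[OF assms, THEN fun_cong, of p] phi_swap[of Y "D X Z", THEN fun_cong, of p]
      phi_swap[of Z "D Y X", THEN fun_cong, of p] phi_swap[of X "D Z Y", THEN fun_cong, of p]
    by (simp add: D_metric dphi_def phi_skew flip: torsion_free)
qed

text \<open>By \<open>D_xi\<close> and the absence of torsion, the curvature on \<xi> is the
  skew-symmetrised derivative of \<open>\<phi> + B\<close>. For arguments in the kernel of \<eta>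
  the nullity condition makes it vanish.\<close>

lemma codazzi:
  assumes "X \<in> V" "Y \<in> V"
  shows "curvature D X Y \<xi> = dphi Y X + dB Y X - dphi X Y - dB X Y"
  unfolding curvature_def dphi_def dB_def using assms
  by (intro vfield_eqI) (simp add: flip: torsion_free)

section \<open>The components of \<open>dphi\<close> and \<open>dB\<close> along the contact
  distribution\<close>

definition "H = {X \<in> V. \<eta> X = 0}"

lemma H_D [simp]: "X \<in> H \<Longrightarrow> X \<in> V" "X \<in> H \<Longrightarrow> \<eta> X = 0"
  and H_I [simp]: "X \<in> V \<Longrightarrow> \<phi> X \<in> H" "X \<in> V \<Longrightarrow> h X \<in> H" "X \<in> V \<Longrightarrow> B X \<in> H"
    "X \<in> V \<Longrightarrow> X - \<eta> X \<cdot> \<xi> \<in> H"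
  by (auto simp: H_def)

definition "F X Y Z = g (dphi X Y) Z"
definition "G X Y Z = g (dB X Y) Z"

lemma F_uminus [simp]:
  assumes "X \<in> V" "Y \<in> V" "Z \<in> V"
  shows "F (- X) Y Z = - F X Y Z" "F X (- Y) Z = - F X Y Z" "F X Y (- Z) = - F X Y Z"
  using assms by (simp_all add: F_def)

lemma G_uminus [simp]:
  assumes "X \<in> V" "Y \<in> V" "Z \<in> V"
  shows "G (- X) Y Z = - G X Y Z" "G X (- Y) Z = - G X Y Z" "G X Y (- Z) = - G X Y Z"
  using assms by (simp_all add: G_def)

lemma F_skew: "X \<in> H \<Longrightarrow> Y \<in> H \<Longrightarrow> Z \<in> H \<Longrightarrow> F X Y Z = - F X Z Y"
  and G_sym: "X \<in> H \<Longrightarrow> Y \<in> H \<Longrightarrow> Z \<in> H \<Longrightarrow> G X Y Z = G X Z Y"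
  and F_cyclic: "X \<in> H \<Longrightarrow> Y \<in> H \<Longrightarrow> Z \<in> H \<Longrightarrow> F X Y Z + F Y Z X + F Z X Y = 0"
  unfolding F_def G_def using dphi_skew[of X Y Z] dB_sym[of X Y Z] dphi_cyclic[of X Y Z] by simp_all

text \<open>The derivative of \<open>\<phi>\<^sup>2 = - I + \<eta> \<otimes> \<xi>\<close>; pairing
  with \<open>Z\<close> in \<open>H\<close> removes the multiple of \<xi>.\<close>

lemma F_phi:
  assumes "X \<in> H" "Y \<in> H" "Z \<in> H"
  shows "F X (\<phi> Y) Z = F X Y (\<phi> Z)"
proof -
  have "dphi X (\<phi> Y) + \<phi> (dphi X Y) = - \<eta> (D X Y) \<cdot> \<xi>"
    unfolding dphi_def using assms by (intro vfield_eqI) simp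
  from this[THEN arg_cong[of _ _ "\<lambda>W. g W Z"]] show ?thesis
    using assms by (simp add: F_def phi_skew add_eq_0_iff)
qed

text \<open>The derivative of \<open>\<phi> B + B \<phi> = 0\<close>.\<close>

lemma G_phi:
  assumes "X \<in> H" "Y \<in> H" "Z \<in> H"
  shows "G X (\<phi> Y) Z + F X Y (B Z) + F X (B Y) Z = G X Y (\<phi> Z)"
proof -
  have "dB X (\<phi> Y) + B (dphi X Y) + \<phi> (dB X Y) + dphi X (B Y) = 0"
    unfolding dphi_def dB_def using assms by (intro vfield_eqI) simp
  from this[THEN arg_cong[of _ _ "\<lambda>W. g W Z"]] show ?thesis
    using assms by (simp add: F_def G_def phi_skew g_B fun_eq_iff) (smt (verit))
qed

text \<open>The derivative of
  \<open>B\<^sup>2 = (1 - \<kappa>) (I - \<eta> \<otimes> \<xi>)\<close>, again paired with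
  \<open>Z\<close> in \<open>H\<close>.\<close>

lemma G_B:
  assumes "X \<in> H" "Y \<in> H" "Z \<in> H"
  shows "G X (B Y) Z = - G X Y (B Z)"
proof -
  have "dB X (B Y) + B (dB X Y) = ((\<lambda>_. 1 - \<kappa>) * \<eta> (D X Y)) \<cdot> \<xi>"
    unfolding dB_def using assms by (intro vfield_eqI) (simp add: algebra_simps)
  from this[THEN arg_cong[of _ _ "\<lambda>W. g W Z"]] show ?thesis
    using assms by (simp add: G_def g_B eq_neg_iff_add_eq_0)
qed

text \<open>In \<open>F_cyclic\<close> the other two terms combine by \<open>F_skew\<close> into a
  skew-symmetrisation of \<open>dphi\<close>, which \<open>codazzi\<close> trades for one of
  \<open>dB\<close>.\<close>

lemma F_eq_G:
  assumes "X \<in> H" "Y \<in> H" "Z \<in> H"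
  shows "F X Y Z = G Y Z X - G Z Y X"
proof
  fix p
  have "dphi Z Y + dB Z Y - dphi Y Z - dB Y Z = 0"
    using codazzi[of Y Z] nullity[of Y Z] assms by simp
  from this[THEN arg_cong[of _ _ "\<lambda>W. g W X p"]] show "F X Y Z p = (G Y Z X - G Z Y X) p"
    using F_cyclic[OF assms, THEN fun_cong, of p] F_skew[of Z X Y] assms
    by (simp add: F_def G_def)
qed

text \<open>\<open>F_cyclic\<close> at \<open>(X, \<phi> Y, \<phi> Z)\<close> and its cyclic shifts
  gives three linear equations for \<open>F (\<phi> X) (\<phi> Y) Z\<close> and its shifts;
  \<open>F_cyclic\<close> at \<open>(X, Y, Z)\<close> then forces these three to sum to
  zero.\<close>

lemma F_phi_phi:
  assumes "X \<in> H" "Y \<in> H" "Z \<in> H"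
  shows "F (\<phi> X) (\<phi> Y) Z = - F X Y Z"
proof
  fix p
  have 1: "- F X Y Z p + F (\<phi> Y) (\<phi> Z) X p + F (\<phi> Z) (\<phi> X) Y p = 0"
    if "X \<in> H" "Y \<in> H" "Z \<in> H" for X Y Z
    using F_cyclic[of X "\<phi> Y" "\<phi> Z", THEN fun_cong, of p] F_phi[of X Y "\<phi> Z"]
      F_phi[of "\<phi> Z" X Y] that by simp
  show "F (\<phi> X) (\<phi> Y) Z p = (- F X Y Z) p"
    using 1[OF assms] 1[OF assms(2,3,1)] 1[OF assms(3,1,2)]
      F_cyclic[OF assms, THEN fun_cong, of p] by simp
qed

text \<open>
  The relations \<open>F_eq_G\<close> at \<open>(X, Y, Z)\<close>, \<open>(X, \<phi>Y, \<phi>Z)\<close>, \<open>(\<phi>X, Y, \<phi>Z)\<close> and \<open>(\<phi>X, \<phi>Y, Z)\<close>,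
  with signs \<open>+ - + +\<close>: on the left everything cancels by \<open>F_phi_phi\<close>, on the right
  \<open>G_phi\<close> turns everything into \<open>F\<close>.
\<close>

lemma F_h:
  assumes H: "X \<in> H" "Y \<in> H" "Z \<in> H"
  shows "F (h X) Y Z = 0"
proof
  fix p
  have 1: "G Y (\<phi> Z) (\<phi> X) p + G Y Z X p + F Y Z (h X) p - F Y (h Z) X p = 0"
    "G (\<phi> Y) (\<phi> Z) X p - G (\<phi> Y) Z (\<phi> X) p - F Y Z (h X) p - F Y (h Z) X p = 0"
    if "Y \<in> H" "Z \<in> H" for Y Z
    using G_phi[of Y Z "\<phi> X", THEN fun_cong, of p] F_phi[of Y "B Z" X, THEN fun_cong, of p]
      G_phi[of "\<phi> Y" Z X, THEN fun_cong, of p] F_phi_phi[of Y "h Z" X, THEN fun_cong, of p]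
      F_phi[of "\<phi> Y" Z "h X", THEN fun_cong, of p] F_phi_phi[of Y Z "h X", THEN fun_cong, of p]
      that H by simp_all
  show "F (h X) Y Z p = 0 p"
    using 1[OF H(2,3)] 1[OF H(3,2)] H
      F_eq_G[of X Y Z, THEN fun_cong, of p] F_eq_G[of X "\<phi> Y" "\<phi> Z", THEN fun_cong, of p]
      F_eq_G[of "\<phi> X" Y "\<phi> Z", THEN fun_cong, of p] F_eq_G[of "\<phi> X" "\<phi> Y" Z, THEN fun_cong, of p]
      F_phi[of X Y "\<phi> Z", THEN fun_cong, of p] F_phi[of "\<phi> X" Y Z, THEN fun_cong, of p]
      F_phi_phi[of X Y Z, THEN fun_cong, of p] F_cyclic[of "h X" Y Z, THEN fun_cong, of p]
      F_skew[of Z "h X" Y, THEN fun_cong, of p]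
    by simp
qed

end

locale non_sasakian_kappa_mu = kappa_mu +
  assumes kappa_less_1: "\<kappa> < 1"
begin

text \<open>The square of \<open>h\<close> is \<open>1 - \<kappa>\<close> on \<open>H\<close>, so
  \<open>\<kappa> < 1\<close> makes \<open>h\<close> invertible there and \<open>F_h\<close> covers
  every first argument.\<close>

lemma F_eq_0:
  assumes "X \<in> H" "Y \<in> H" "Z \<in> H"
  shows "F X Y Z = 0"
proof -
  have "(\<lambda>_. 1 - \<kappa>) * F X Y Z = 0"
    using F_h[of "h X" Y Z] assms by (simp add: F_def)
  then show ?thesis using kappa_less_1 by (simp add: fun_eq_iff)
qed

text \<open>On \<open>H\<close> the tensor \<open>G\<close> is now totally symmetric, while \<open>B\<close> is skew for it in any two slots.\<close>

lemma G_eq_0: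
  assumes "X \<in> H" "Y \<in> H" "Z \<in> H"
  shows "G X Y Z = 0"
proof -
  have swap: "G X Y Z = G Y X Z" if "X \<in> H" "Y \<in> H" "Z \<in> H" for X Y Z
    using F_eq_G[of Z X Y] F_eq_0[of Z X Y] that by simp
  \<comment> \<open>Carrying \<open>B\<close> through the three slots back to its start changes the
    sign three times.\<close>
  have *: "G (B X) Y Z = 0" if H: "X \<in> H" "Y \<in> H" "Z \<in> H" for X Y Z
  proof
    fix p
    have "G (B X) Y Z = - G X Y (B Z)"
      using H swap[of "B X" Y Z] swap[of X Y "B Z"] G_B[of Y X Z] by simp
    moreover have "G (B X) Y Z = - G X (B Y) Z"
      using H G_sym[of "B X" Y Z] swap[of "B X" Z Y] G_B[of Z X Y] swap[of Z X "B Y"]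
        G_sym[of X Z "B Y"] by simp
    ultimately show "G (B X) Y Z p = 0 p"
      using H G_B[of X Y Z, THEN fun_cong, of p] by simp
  qed
  have "(\<lambda>_. 1 - \<kappa>) * G X Y Z = 0"
    using *[of "B X" Y Z] assms by (simp add: G_def)
  then show ?thesis using kappa_less_1 by (simp add: fun_eq_iff)
qed

section \<open>From the contact distribution back to all vector fields\<close>

lemma eta_dphi:
  assumes "X \<in> V" "Y \<in> V"
  shows "\<eta> (dphi X Y) = g X Y + g (h X) Y - \<eta> X * \<eta> Y"
  using dphi_skew[of X Y \<xi>] assms by (simp add: algebra_simps)

lemma dphi_eq:
  assumes "X \<in> V" "Y \<in> V"
  shows "dphi X Y = (g X Y + g (h X) Y) \<cdot> \<xi> - \<eta> Y \<cdot> (X + h X)"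
    (is "_ = ?R")
proof (rule nondegenerate)
  fix Z assume Z: "Z \<in> V"
  \<comment> \<open>Removing the \<xi>-components puts all arguments into \<open>H\<close>.
    Expanding by linearity leaves, besides the wanted component, only terms with an argument \<xi>,
    which are known.\<close>
  have *: "F (X - \<eta> X \<cdot> \<xi>) (Y - \<eta> Y \<cdot> \<xi>) (Z - \<eta> Z \<cdot> \<xi>) = 0"
    using assms Z by (intro F_eq_0) simp_all
  have "g (dphi X Y) Z p = g ?R Z p" for p
    using *[THEN fun_cong, of p] assms Z by (simp add: F_def eta_dphi algebra_simps)
  then show "g (dphi X Y) Z = g ?R Z" ..
qed (use assms in simp_all)

lemma eta_dB:
  assumes "X \<in> V" "Y \<in> V"
  shows "\<eta> (dB X Y) = g (h X) Y + (\<lambda>_. 1 - \<kappa>) * (g X Y - \<eta> X * \<eta> Y)"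
  using dB_sym[of X Y \<xi>] assms by (simp add: algebra_simps)

lemma dB_eq:
  assumes "X \<in> V" "Y \<in> V"
  shows "dB X Y = \<eta> Y \<cdot> (h X + cscale (1 - \<kappa>) (X - \<eta> X \<cdot> \<xi>))
    + (g (h X) Y + (\<lambda>_. 1 - \<kappa>) * (g X Y - \<eta> X * \<eta> Y)) \<cdot> \<xi> + \<eta> X \<cdot> cscale \<mu> (h Y)"
    (is "_ = ?R")
proof (rule nondegenerate)
  fix Z assume Z: "Z \<in> V"
  have *: "G (X - \<eta> X \<cdot> \<xi>) (Y - \<eta> Y \<cdot> \<xi>) (Z - \<eta> Z \<cdot> \<xi>) = 0"
    using assms Z by (intro G_eq_0) simp_all
  have "g (dB X Y) Z p = g ?R Z p" for p
    using *[THEN fun_cong, of p] assms Z by (simp add: G_def eta_dB algebra_simps)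
  then show "g (dB X Y) Z = g ?R Z" ..
qed (use assms in simp_all)

end


section \<open>The Sasakian deformation\<close>

text \<open>The assumption \<open>ratio_ab\<close> is \<open>a = b * (1 - \<mu> / 2)\<close>, solved
  for the product \<open>b * \<mu>\<close> so that it can eliminate \<mu>.\<close>

locale sasakian_deformation = non_sasakian_kappa_mu +
  fixes a b :: real
  assumes a_pos: "a > 0"
    and norm_ab: "a * a - b * b * (1 - \<kappa>) = 1"
    and ratio_ab: "b * \<mu> = 2 * (b - a)"
begin

definition "phi' X = cscale a (\<phi> X) + cscale b (B X)"
definition "g' X Y = (\<lambda>_. a) * g X Y + (\<lambda>_. b) * g (h X) Y + (\<lambda>_. 1 - a) * (\<eta> X * \<eta> Y)"
definition "S X = cscale (1 - a) (\<phi> X) + cscale (1 - b) (B X)"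
definition "D' X Y = D X Y - g (B X) Y \<cdot> \<xi> + \<eta> X \<cdot> S Y + \<eta> Y \<cdot> S X"

text \<open>\<open>norm_ab\<close> as a rewrite rule, in the right-nested form into which
  \<open>algebra_simps\<close> brings products. \<open>b_mu\<close> and \<open>mu_b\<close> do the
  same for \<open>ratio_ab\<close>, one for each order of the factors.\<close>

lemma a_a: "a * (a * x) = x + b * (b * x) - \<kappa> * (b * (b * x))"
proof -
  have "a * (a * x) = (1 + b * b * (1 - \<kappa>)) * x"
    using norm_ab by simp
  then show ?thesis by (simp add: algebra_simps)
qed

lemma b_mu: "b * (\<mu> * x) = 2 * (b * x) - 2 * (a * x)"
proof -
  have "b * (\<mu> * x) = (2 * (b - a)) * x"
    using ratio_ab by simp
  then show ?thesis by (simp add: algebra_simps)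
qed

lemma mu_b: "\<mu> * (b * x) = 2 * (b * x) - 2 * (a * x)"
  using b_mu[of x] by (simp add: mult.left_commute)

lemma tensor_phi': "tensor_field_11 A phi'"
  unfolding tensor_field_11_def phi'_def by (auto intro!: vfield_eqI simp: algebra_simps)

lemma tensor_S: "tensor_field_11 A S"
  unfolding tensor_field_11_def S_def by (auto intro!: vfield_eqI simp: algebra_simps)

lemmas phi'_simps [simp] = tensor_11D[OF tensor_phi']
lemmas S_simps [simp] = tensor_11D[OF tensor_S]

lemma g'_form: "X \<in> V \<Longrightarrow> one_form A (g' X)"
  unfolding one_form_def g'_def by (auto simp: algebra_simps)

lemma g'_sym: "X \<in> V \<Longrightarrow> Y \<in> V \<Longrightarrow> g' X Y = g' Y X"
  using g_h[of X Y] g_sym[of X "h Y"] g_sym[of X Y] by (simp add: g'_def mult.commute)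

text \<open>
  If \<open>Z\<close> vanishes at \<open>p\<close>, then \<open>g Z Z p\<close> is the limit of \<open>g (Z + e X) (Z + e X) p\<close>. This avoids
  the proof that \<open>g\<close> depends on the values of vector fields at \<open>p\<close> only.
\<close>

lemma g_nonneg:
  assumes Z: "Z \<in> V" and X: "X \<in> V" "nonzero_at A X p"
  shows "g Z Z p \<ge> 0"
proof (cases "nonzero_at A Z p")
  case True
  then show ?thesis using g_pos[OF Z] by force
next
  case False
  have *: "g Z Z p + e * (2 * g Z X p + e * g X X p) > 0" if "e \<noteq> 0" for e
  proof -
    have "nonzero_at A (Z + cscale e X) p"
      using False X(2) that Z X(1) by (auto simp: nonzero_at_def fscale_def)
    then have "g (Z + cscale e X) (Z + cscale e X) p > 0"
      by (rule g_pos[rotated]) (simp add: Z X)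
    then show ?thesis
      using Z X(1) by (simp add: g_sym[of Z X] algebra_simps)
  qed
  have "((\<lambda>e. g Z Z p + e * (2 * g Z X p + e * g X X p)) \<longlongrightarrow>
      g Z Z p + 0 * (2 * g Z X p + 0 * g X X p)) (at 0)"
    by (intro tendsto_intros)
  then have "((\<lambda>e. g Z Z p + e * (2 * g Z X p + e * g X X p)) \<longlongrightarrow> g Z Z p) (at 0)"
    by simp
  moreover have "\<forall>\<^sub>F e in at (0::real). g Z Z p + e * (2 * g Z X p + e * g X X p) \<ge> 0"
    using * by (auto simp: eventually_at intro!: exI[of _ 1] less_imp_le)
  ultimately show ?thesis
    by (rule tendsto_lowerbound) simp
qed

text \<open>On the kernel of \<eta>, \<open>norm_ab\<close> gives
  \<open>(a I + b h)\<^sup>2 = 2a (a I + b h) - I\<close>. The square is nonnegative because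
  \<open>h\<close> is symmetric, so \<open>2a (a I + b h)\<close> is at least the identity;
  \<open>Z\<close> below is the image under \<open>a I + b h\<close> of the horizontal part of
  \<open>X\<close>.\<close>

lemma g'_pos:
  assumes X: "X \<in> V" and nz: "nonzero_at A X p"
  shows "g' X X p > 0"
proof -
  define u where "u = g X X p - \<eta> X p * \<eta> X p"
  define w where "w = g (h X) X p"
  have hh: "g (h X) (h X) p = (1 - \<kappa>) * u"
    using X g_h[of "h X" X] by (simp add: u_def g_sym[of \<xi>])
  have "g (X - \<eta> X \<cdot> \<xi>) (X - \<eta> X \<cdot> \<xi>) p \<ge> 0"
    by (rule g_nonneg[OF _ X nz]) (simp add: X)
  then have u: "u \<ge> 0"
    using X by (simp add: u_def)
  define Z where "Z = cscale a (X - \<eta> X \<cdot> \<xi>) + cscale b (h X)"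
  have "g Z Z p \<ge> 0"
    by (rule g_nonneg[OF _ X nz]) (simp add: X Z_def)
  also have "g Z Z p = a * a * u + 2 * a * b * w + b * b * ((1 - \<kappa>) * u)"
    using X by (simp add: Z_def hh) (simp add: u_def w_def g_sym[of X "h X"] algebra_simps)
  also have "\<dots> = (a * a + b * b * (1 - \<kappa>)) * u + 2 * a * b * w"
    by (simp add: algebra_simps)
  also have "\<dots> = (2 * (a * a) - 1) * u + 2 * a * b * w"
    by (simp add: algebra_simps a_a)
  finally have 1: "2 * a * (a * u + b * w) \<ge> u"
    by (simp add: algebra_simps)
  have pos: "u + \<eta> X p * \<eta> X p > 0"
    using g_pos[OF X nz] by (simp add: u_def)
  have "g' X X p = (a * u + b * w) + \<eta> X p * \<eta> X p"
    by (simp add: g'_def u_def w_def algebra_simps)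
  moreover have "a * u + b * w \<ge> 0" "u > 0 \<Longrightarrow> a * u + b * w > 0"
    using 1 u a_pos by (smt (verit) mult_pos_neg mult_nonneg_nonpos)+
  ultimately show ?thesis
    using pos u by (smt (verit) mult_eq_0_iff not_real_square_gt_zero)
qed

lemma phi'_phi': "X \<in> V \<Longrightarrow> phi' (phi' X) = - X + \<eta> X \<cdot> \<xi>"
  unfolding phi'_def by (rule vfield_eqI) (simp add: algebra_simps a_a)

text \<open>On the kernel of \<eta>, \<open>(a I + b h)(a \<phi> + b B)\<close> equals
  \<open>(a\<^sup>2 - b\<^sup>2 (1 - \<kappa>)) \<phi>\<close>, which is \<phi> by
  \<open>norm_ab\<close>. Hence the new structure has the same \<open>d\<eta>\<close>.\<close>

lemma g'_phi': "X \<in> V \<Longrightarrow> Y \<in> V \<Longrightarrow> g' X (phi' Y) = g X (\<phi> Y)"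
  by (rule ext) (simp add: g'_def phi'_def phi_skew g_B algebra_simps a_a)

lemma g'_phi'_phi':
  assumes "X \<in> V" "Y \<in> V"
  shows "g' (phi' X) (phi' Y) = g' X Y - \<eta> X * \<eta> Y"
  unfolding g'_def phi'_def using assms
  by (intro ext) (simp add: phi_skew g_B algebra_simps a_a)

lemma contact_metric': "contact_metric_structure A n phi' \<xi> \<eta> g'"
  unfolding contact_metric_structure_def riemannian_metric_def
  using contact_manifold reeb_field tensor_phi' g'_form g'_sym g'_pos phi'_phi' g'_phi'_phi'
  by (auto simp: d_eta g'_phi')

section \<open>The Levi-Civita connection and the curvature of \<open>g'\<close>\<close>

lemma B_swap: "X \<in> V \<Longrightarrow> Y \<in> V \<Longrightarrow> g (B X) Y = g (B Y) X"
  using g_B[of Y X] g_sym[of Y "B X"] by simp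

lemma h_swap: "X \<in> V \<Longrightarrow> Y \<in> V \<Longrightarrow> g (h X) Y = g (h Y) X"
  using g_h[of Y X] g_sym[of Y "h X"] by simp

lemma D'_metric:
  assumes "X \<in> V" "Y \<in> V" "Z \<in> V"
  shows "X \<rhd> g' Y Z = g' (D' X Y) Z + g' Y (D' X Z)"
proof
  fix p
  \<comment> \<open>Writing \<open>h = B \<phi>\<close> reduces the derivative of \<open>h\<close>
    to \<open>dB\<close> and \<open>dphi\<close>.\<close>
  have hY: "D X (h Y) = h (D X Y) + dB X (\<phi> Y) + B (dphi X Y)"
    unfolding dphi_def dB_def using assms by (intro vfield_eqI) simp
  have eta: "X \<rhd> \<eta> W = \<eta> (D X W) - g (\<phi> X) W - g (B X) W" if "W \<in> V" for W
    using D_metric[of X \<xi> W] that assms by (simp add: algebra_simps)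
  show "(X \<rhd> g' Y Z) p = (g' (D' X Y) Z + g' Y (D' X Z)) p"
    using assms
    by (simp add: g'_def D'_def S_def D_metric hY eta dphi_eq dB_eq)
      (simp add: phi_skew g_B g_h phi_swap[of Y X] phi_swap[of Z X] phi_swap[of Z Y]
        B_swap[of Y X] B_swap[of Z X] B_swap[of Z Y] algebra_simps a_a b_mu mu_b)
qed

lemma levi_civita': "levi_civita_connection A g' D'"
  unfolding levi_civita_connection_def
proof (intro conjI ballI)
  fix X Y Z assume V: "X \<in> V" "Y \<in> V" "Z \<in> V"
  show "X (g' Y Z) = g' (D' X Y) Z + g' Y (D' X Z)"
    using D'_metric[OF V] by (simp add: der_def)
next
  fix X Y f assume V: "X \<in> V" "Y \<in> V" and f: "f \<in> C"
  have "D' X (f \<cdot> Y) = (X \<rhd> f) \<cdot> Y + f \<cdot> D' X Y"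
    unfolding D'_def using V f by (intro vfield_eqI) (simp add: algebra_simps)
  then show "D' X (f \<cdot> Y) = X f \<cdot> Y + f \<cdot> D' X Y"
    by (simp only: der_def)
next
  fix X Y assume V: "X \<in> V" "Y \<in> V"
  show "D' X Y - D' Y X = lie_bracket X Y"
    unfolding D'_def using V g_B[of X Y] g_sym[of X "B Y"]
    by (intro vfield_eqI) (simp add: algebra_simps flip: torsion_free)
qed (auto intro!: vfield_eqI simp: D'_def algebra_simps)

text \<open>Since \<open>D' W \<xi> = - phi' W\<close>, the curvature on \<xi> is the
  skew-symmetrised derivative of \<open>phi'\<close>, explicit by \<open>dphi_eq\<close> and
  \<open>dB_eq\<close>. The relations between \<open>a\<close> and \<open>b\<close> then eliminate
  \<kappa> and \<mu>.\<close>

lemma curvature':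
  assumes "X \<in> V" "Y \<in> V"
  shows "curvature D' X Y \<xi> = \<eta> Y \<cdot> X - \<eta> X \<cdot> Y"
proof -
  have xi: "D' W \<xi> = - phi' W" if "W \<in> V" for W
    using that by (intro vfield_eqI) (simp add: D'_def S_def phi'_def algebra_simps)
  have D_phi': "D' W (phi' W') = cscale a (dphi W W') + cscale b (dB W W') + phi' (D W W')
      - g (B W) (phi' W') \<cdot> \<xi> + \<eta> W \<cdot> S (phi' W')"
    if "W \<in> V" "W' \<in> V" for W W'
    using that
    by (intro vfield_eqI) (simp add: D'_def, simp add: phi'_def dphi_def dB_def algebra_simps)
  have minus: "D' W (- W') = - D' W W'" if "W \<in> V" "W' \<in> V" for W W'
    unfolding D'_def using that by (intro vfield_eqI) simp
  have curv: "curvature D' X Y \<xi> = D' Y (phi' X) - D' X (phi' Y) + phi' (D X Y - D Y X)"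
    unfolding curvature_def using assms by (intro vfield_eqI) (simp add: xi minus torsion_free)
  show ?thesis
    using assms
    by (intro vfield_eqI, simp add: curv D_phi' dphi_eq dB_eq)
      (simp add: S_def phi'_def phi_skew g_B B_swap[of Y X] phi_swap[of Y X] h_swap[of Y X]
        g_sym[of Y X] algebra_simps a_a b_mu mu_b)
qed

lemma sasakian: "sasakian_structure A n phi' \<xi> \<eta> g'"
  unfolding sasakian_structure_def using contact_metric' levi_civita' curvature' by blast

end

theorem corollary3p7:
  fixes A :: "('a::{t2_space,second_countable_topology}, 'e::euclidean_space) atlas"
    and n :: nat
    and \<phi> :: "'a vfield \<Rightarrow> 'a vfield"
    and \<xi> :: "'a vfield"
    and \<eta> :: "'a vfield \<Rightarrow> 'a \<Rightarrow> real"
    and g :: "'a vfield \<Rightarrow> 'a vfield \<Rightarrow> 'a \<Rightarrow> real"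
    and \<kappa> \<mu> :: real
  assumes "kappa_mu_structure A n \<phi> \<xi> \<eta> g \<kappa> \<mu>"
    and "\<kappa> < 1"
    and "\<bar>boeckx_invariant \<kappa> \<mu>\<bar> > 1"
  shows "\<exists>\<phi>' g'. sasakian_structure A n \<phi>' \<xi> \<eta> g'"
proof -
  obtain D where cms: "contact_metric_structure A n \<phi> \<xi> \<eta> g"
    and D: "levi_civita_connection A g D"
    and curv: "\<forall>X\<in>vector_fields A. \<forall>Y\<in>vector_fields A. curvature D X Y \<xi> =
      cscale \<kappa> (\<eta> Y \<cdot> X - \<eta> X \<cdot> Y) +
      cscale \<mu> (\<eta> Y \<cdot> h_tensor \<phi> \<xi> X - \<eta> X \<cdot> h_tensor \<phi> \<xi> Y)"
    using assms(1) unfolding kappa_mu_structure_def by blast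
  define \<alpha> where "\<alpha> = 1 - \<mu> / 2"
  have "sqrt (1 - \<kappa>) < \<bar>\<alpha>\<bar>"
    using assms(2,3) by (simp add: boeckx_invariant_def \<alpha>_def)
  then have pos: "1 - \<kappa> < \<alpha>\<^sup>2"
    by (metis abs_ge_zero not_le real_sqrt_abs real_sqrt_less_iff)
  define s where "s = sqrt (\<alpha>\<^sup>2 - (1 - \<kappa>))"
  have s: "s > 0" "s * s = \<alpha>\<^sup>2 - (1 - \<kappa>)"
    using pos by (auto simp: s_def)
  have "\<alpha> \<noteq> 0"
    using pos assms(2) by auto
  \<comment> \<open>Division by \<open>s\<close> gives \<open>norm_ab\<close>. The factor
    \<open>sgn \<alpha>\<close> makes \<open>b * \<alpha>\<close> equal to \<open>a\<close> for
    either sign of the invariant, while \<open>a\<close> stays positive.\<close>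
  interpret sasakian_deformation A n \<phi> \<xi> \<eta> g D \<kappa> \<mu> "\<bar>\<alpha>\<bar> / s" "sgn \<alpha> / s"
  proof unfold_locales
    show "smooth_manifold A"
      using cms by (simp add: contact_metric_structure_def contact_manifold_def)
    show "\<bar>\<alpha>\<bar> / s * (\<bar>\<alpha>\<bar> / s) - sgn \<alpha> / s * (sgn \<alpha> / s) * (1 - \<kappa>) = 1"
      using s \<open>\<alpha> \<noteq> 0\<close> by (simp add: field_simps power2_eq_square sgn_if)
    have "sgn \<alpha> * \<mu> = 2 * (sgn \<alpha> - \<bar>\<alpha>\<bar>)"
      by (simp add: \<alpha>_def sgn_if field_simps abs_if)
    then show "sgn \<alpha> / s * \<mu> = 2 * (sgn \<alpha> / s - \<bar>\<alpha>\<bar> / s)"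
      using s by (simp add: field_simps)
  qed (use cms D curv assms(2) s \<open>\<alpha> \<noteq> 0\<close> in auto)
  show ?thesis
    using sasakian by blast
qed

end
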